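(* Let $V$ be a finite-dimensional irreducible $\mathcal{O}$-module of type $(0,0)$. Then there exists a unique $\boxtimes$-module structure on $V$ such that the standard generators $X,Y$ of $\mathcal{O}$ act on $V$ as $X_{01},X_{23}$ respectively. This $\boxtimes$-module structure is irreducible.
   Context: $\mathbb{K}$ is an algebraically closed field of characteristic $0$. All Lie algebras and modules are over $\mathbb{K}$; irreducible modules are nonzero. Tetrahedron algebra: let $\mathbb{I}=\{0,1,2,3\}$. $\boxtimes$ is the Lie algebra over $\mathbb{K}$ with generators $\{X_{rs} \mid r,s\in\mathbb{I}, r\neq s\}$ and relations: (i) for distinct $r,s\in\mathbb{I}$, $X_{rs}+X_{sr}=0$; (ii) for mutually distinct $r,s,t\in\mathbb{I}$, $[X_{rs},X_{st}]=2X_{rs}+2X_{st}$; (iii) for mutually distinct $r,s,t,u\in\mathbb{I}$, $[X_{rs},[X_{rs},[X_{rs},X_{tu}]]]=4[X_{rs},X_{tu}]$. Onsager algebra: $\mathcal{O}$ is the Lie algebra over $\mathbb{K}$ with generators $X,Y$ (the standard generators) and relations $[X,[X,[X,Y]]]=4[X,Y]$ and $[Y,[Y,[Y,X]]]=4[Y,X]$. Type: for every finite-dimensional irreducible $\mathcal{O}$-module $V$, $X$ and $Y$ are diagonalizable on $V$ and there exist an integer $d\geq 0$ and scalars $\alpha,\alpha^*\in\mathbb{K}$ such that the set of distinct eigenvalues of $X$ (resp. $Y$) on $V$ is $\{d-2i+\alpha \mid 0\leq i\leq d\}$ (resp. $\{d-2i+\alpha^* \mid 0\leq i\leq d\}$).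 The ordered pair $(\alpha,\alpha^* )$ is called the type of $V$, and $d$ its diameter. *)

theory Defs
  imports "HOL-Computational_Algebra.Polynomial"
begin

section \<open>Lie algebras and their modules\<close>

locale lie_algebra = vector_space scale
  for scale :: "'k::field \<Rightarrow> 'l::ab_group_add \<Rightarrow> 'l" +
  fixes bracket :: "'l \<Rightarrow> 'l \<Rightarrow> 'l"
  assumes bracket_linear_left: "Vector_Spaces.linear scale scale (\<lambda>x. bracket x y)"
    and bracket_linear_right: "Vector_Spaces.linear scale scale (bracket x)"
    and bracket_self: "bracket x x = 0"
    and jacobi: "bracket x (bracket y z) + bracket y (bracket z x) + bracket z (bracket x y) = 0"

text \<open>The underlying vector space of a module is an entire type, with its scalar
  multiplication as a parameter.\<close>

locale lie_module =
  L: lie_algebra scaleL bracket + V: vector_space scaleV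
  for scaleL :: "'k::field \<Rightarrow> 'l::ab_group_add \<Rightarrow> 'l"
    and bracket :: "'l \<Rightarrow> 'l \<Rightarrow> 'l"
    and scaleV :: "'k \<Rightarrow> 'v::ab_group_add \<Rightarrow> 'v" +
  fixes act :: "'l \<Rightarrow> 'v \<Rightarrow> 'v"
  assumes act_linear_left: "Vector_Spaces.linear scaleL scaleV (\<lambda>x. act x v)"
    and act_linear_right: "Vector_Spaces.linear scaleV scaleV (act x)"
    and act_bracket: "act (bracket x y) v = act x (act y v) - act y (act x v)"

locale irreducible_lie_module = lie_module scaleL bracket scaleV act
  for scaleL :: "'k::field \<Rightarrow> 'l::ab_group_add \<Rightarrow> 'l"
    and bracket :: "'l \<Rightarrow> 'l \<Rightarrow> 'l"
    and scaleV :: "'k \<Rightarrow> 'v::ab_group_add \<Rightarrow> 'v"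
    and act :: "'l \<Rightarrow> 'v \<Rightarrow> 'v" +
  assumes nonzero: "\<exists>v::'v. v \<noteq> 0"
    and irreducible:
      "\<lbrakk>V.subspace W; \<And>x w. w \<in> W \<Longrightarrow> act x w \<in> W\<rbrakk> \<Longrightarrow> W = {0} \<or> W = UNIV"

section \<open>Lie algebras given by generators and relations\<close>

datatype ('k, 'g) lie_term =
    Gen 'g
  | Zero
  | Add "('k, 'g) lie_term" "('k, 'g) lie_term"
  | Neg "('k, 'g) lie_term"
  | Scale 'k "('k, 'g) lie_term"
  | Bracket "('k, 'g) lie_term" "('k, 'g) lie_term"

text \<open>The smallest congruence on terms that contains the relations \<open>R\<close> and satisfies the
  Lie algebra axioms. The terms modulo this congruence form the Lie algebra presented by
  the generators \<open>'g\<close> and the relations \<open>R\<close>.\<close>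

inductive lie_eq ::
  "(('k::field, 'g) lie_term \<times> ('k, 'g) lie_term) set \<Rightarrow>
   ('k, 'g) lie_term \<Rightarrow> ('k, 'g) lie_term \<Rightarrow> bool"
  for R where
  relation: "(s, t) \<in> R \<Longrightarrow> lie_eq R s t"
| refl: "lie_eq R s s"
| sym: "lie_eq R s t \<Longrightarrow> lie_eq R t s"
| trans: "lie_eq R s t \<Longrightarrow> lie_eq R t u \<Longrightarrow> lie_eq R s u"
| cong_Add: "lie_eq R s s' \<Longrightarrow> lie_eq R t t' \<Longrightarrow> lie_eq R (Add s t) (Add s' t')"
| cong_Neg: "lie_eq R s s' \<Longrightarrow> lie_eq R (Neg s) (Neg s')"
| cong_Scale: "lie_eq R s s' \<Longrightarrow> lie_eq R (Scale c s) (Scale c s')"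
| cong_Bracket: "lie_eq R s s' \<Longrightarrow> lie_eq R t t' \<Longrightarrow> lie_eq R (Bracket s t) (Bracket s' t')"
| Add_assoc: "lie_eq R (Add (Add s t) u) (Add s (Add t u))"
| Add_commute: "lie_eq R (Add s t) (Add t s)"
| Add_Zero: "lie_eq R (Add Zero s) s"
| Add_Neg: "lie_eq R (Add (Neg s) s) Zero"
| Scale_Add: "lie_eq R (Scale c (Add s t)) (Add (Scale c s) (Scale c t))"
| Scale_add: "lie_eq R (Scale (c + d) s) (Add (Scale c s) (Scale d s))"
| Scale_Scale: "lie_eq R (Scale c (Scale d s)) (Scale (c * d) s)"
| Scale_one: "lie_eq R (Scale 1 s) s"
| Bracket_Add_left: "lie_eq R (Bracket (Add s t) u) (Add (Bracket s u) (Bracket t u))"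
| Bracket_Add_right: "lie_eq R (Bracket s (Add t u)) (Add (Bracket s t) (Bracket s u))"
| Bracket_Scale_left: "lie_eq R (Bracket (Scale c s) t) (Scale c (Bracket s t))"
| Bracket_Scale_right: "lie_eq R (Bracket s (Scale c t)) (Scale c (Bracket s t))"
| Bracket_self: "lie_eq R (Bracket s s) Zero"
| Jacobi: "lie_eq R (Add (Add (Bracket s (Bracket t u)) (Bracket t (Bracket u s)))
                       (Bracket u (Bracket s t))) Zero"

lemma equivp_lie_eq: "equivp (lie_eq R)"
  by (intro equivpI reflpI sympI transpI) (fact lie_eq.refl | erule lie_eq.sym | erule (1) lie_eq.trans)+

section \<open>The Onsager algebra\<close>

datatype onsager_gen = GenX | GenY

definition onsager_relations ::
  "(('k::field, onsager_gen) lie_term \<times> ('k, onsager_gen) lie_term) set" where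
  "onsager_relations =
    (let X = Gen GenX; Y = Gen GenY in
     {(Bracket X (Bracket X (Bracket X Y)), Scale 4 (Bracket X Y)),
      (Bracket Y (Bracket Y (Bracket Y X)), Scale 4 (Bracket Y X))})"

quotient_type (overloaded) 'k onsager =
  "('k::field, onsager_gen) lie_term" / "lie_eq onsager_relations"
  by (rule equivp_lie_eq)

instantiation onsager :: (field) ab_group_add
begin

lift_definition zero_onsager :: "'a onsager" is Zero .
lift_definition plus_onsager :: "'a onsager \<Rightarrow> 'a onsager \<Rightarrow> 'a onsager" is Add
  by (rule lie_eq.cong_Add)
lift_definition uminus_onsager :: "'a onsager \<Rightarrow> 'a onsager" is Neg
  by (rule lie_eq.cong_Neg)
definition minus_onsager :: "'a onsager \<Rightarrow> 'a onsager \<Rightarrow> 'a onsager" where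
  "x - y = x + - (y :: 'a onsager)"

instance
proof
  fix a b c :: "'a onsager"
  show "a + b + c = a + (b + c)" by transfer (rule lie_eq.Add_assoc)
  show "a + b = b + a" by transfer (rule lie_eq.Add_commute)
  show "0 + a = a" by transfer (rule lie_eq.Add_Zero)
  show "- a + a = 0" by transfer (rule lie_eq.Add_Neg)
  show "a - b = a + - b" by (rule minus_onsager_def)
qed

end

lift_definition onsager_scale :: "'k::field \<Rightarrow> 'k onsager \<Rightarrow> 'k onsager" is Scale
  by (rule lie_eq.cong_Scale)
lift_definition onsager_bracket :: "'k::field onsager \<Rightarrow> 'k onsager \<Rightarrow> 'k onsager" is Bracket
  by (rule lie_eq.cong_Bracket)
lift_definition onsager_X :: "'k::field onsager" is "Gen GenX" .
lift_definition onsager_Y :: "'k::field onsager" is "Gen GenY" .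

lemma lie_algebra_onsager:
  "lie_algebra (onsager_scale :: 'k::field \<Rightarrow> _) onsager_bracket"
proof -
  have "vector_space (onsager_scale :: 'k \<Rightarrow> _)"
    by unfold_locales
      (transfer, rule lie_eq.Scale_Add lie_eq.Scale_add lie_eq.Scale_Scale lie_eq.Scale_one)+
  moreover have "onsager_bracket (x + y) z = onsager_bracket x z + onsager_bracket y z"
    "onsager_bracket x (y + z) = onsager_bracket x y + onsager_bracket x z"
    "onsager_bracket (onsager_scale c x) y = onsager_scale c (onsager_bracket x y)"
    "onsager_bracket x (onsager_scale c y) = onsager_scale c (onsager_bracket x y)"
    "onsager_bracket x x = 0"
    "onsager_bracket x (onsager_bracket y z) + onsager_bracket y (onsager_bracket z x) +
       onsager_bracket z (onsager_bracket x y) = 0"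
    for x y z :: "'k onsager" and c
    by (transfer, rule lie_eq.Bracket_Add_left lie_eq.Bracket_Add_right lie_eq.Bracket_Scale_left
          lie_eq.Bracket_Scale_right lie_eq.Bracket_self lie_eq.Jacobi)+
  ultimately show ?thesis
    by (simp add: lie_algebra_def lie_algebra_axioms_def Vector_Spaces.linear_iff)
qed

section \<open>The tetrahedron algebra\<close>

definition tetra_index :: "nat set" where
  "tetra_index = {0, 1, 2, 3}"

typedef tetra_gen = "{(r, s). r \<in> tetra_index \<and> s \<in> tetra_index \<and> r \<noteq> s}"
  by (rule exI[of _ "(0, 1)"]) (simp add: tetra_index_def)

text \<open>\<open>Abs_tetra_gen\<close> is unspecified outside its domain, so \<open>tetra_X r s\<close> below is
  meaningful only for distinct \<open>r\<close> and \<open>s\<close> in \<open>tetra_index\<close>.\<close>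

abbreviation tetra_Gen :: "nat \<Rightarrow> nat \<Rightarrow> ('k, tetra_gen) lie_term" where
  "tetra_Gen r s \<equiv> Gen (Abs_tetra_gen (r, s))"

definition tetra_relations ::
  "(('k::field, tetra_gen) lie_term \<times> ('k, tetra_gen) lie_term) set" where
  "tetra_relations =
    {(Add (tetra_Gen r s) (tetra_Gen s r), Zero) | r s.
       {r, s} \<subseteq> tetra_index \<and> distinct [r, s]} \<union>
    {(Bracket (tetra_Gen r s) (tetra_Gen s t),
      Add (Scale 2 (tetra_Gen r s)) (Scale 2 (tetra_Gen s t))) | r s t.
       {r, s, t} \<subseteq> tetra_index \<and> distinct [r, s, t]} \<union>
    {(Bracket (tetra_Gen r s) (Bracket (tetra_Gen r s) (Bracket (tetra_Gen r s) (tetra_Gen t u))),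
      Scale 4 (Bracket (tetra_Gen r s) (tetra_Gen t u))) | r s t u.
       {r, s, t, u} \<subseteq> tetra_index \<and> distinct [r, s, t, u]}"

quotient_type (overloaded) 'k tetrahedron =
  "('k::field, tetra_gen) lie_term" / "lie_eq tetra_relations"
  by (rule equivp_lie_eq)

instantiation tetrahedron :: (field) ab_group_add
begin

lift_definition zero_tetrahedron :: "'a tetrahedron" is Zero .
lift_definition plus_tetrahedron :: "'a tetrahedron \<Rightarrow> 'a tetrahedron \<Rightarrow> 'a tetrahedron" is Add
  by (rule lie_eq.cong_Add)
lift_definition uminus_tetrahedron :: "'a tetrahedron \<Rightarrow> 'a tetrahedron" is Neg
  by (rule lie_eq.cong_Neg)
definition minus_tetrahedron :: "'a tetrahedron \<Rightarrow> 'a tetrahedron \<Rightarrow> 'a tetrahedron" where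
  "x - y = x + - (y :: 'a tetrahedron)"

instance
proof
  fix a b c :: "'a tetrahedron"
  show "a + b + c = a + (b + c)" by transfer (rule lie_eq.Add_assoc)
  show "a + b = b + a" by transfer (rule lie_eq.Add_commute)
  show "0 + a = a" by transfer (rule lie_eq.Add_Zero)
  show "- a + a = 0" by transfer (rule lie_eq.Add_Neg)
  show "a - b = a + - b" by (rule minus_tetrahedron_def)
qed

end

lift_definition tetra_scale :: "'k::field \<Rightarrow> 'k tetrahedron \<Rightarrow> 'k tetrahedron" is Scale
  by (rule lie_eq.cong_Scale)
lift_definition tetra_bracket :: "'k::field tetrahedron \<Rightarrow> 'k tetrahedron \<Rightarrow> 'k tetrahedron"
  is Bracket
  by (rule lie_eq.cong_Bracket)
lift_definition tetra_X :: "nat \<Rightarrow> nat \<Rightarrow> 'k::field tetrahedron" is tetra_Gen .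

lemma lie_algebra_tetrahedron:
  "lie_algebra (tetra_scale :: 'k::field \<Rightarrow> _) tetra_bracket"
proof -
  have "vector_space (tetra_scale :: 'k \<Rightarrow> _)"
    by unfold_locales
      (transfer, rule lie_eq.Scale_Add lie_eq.Scale_add lie_eq.Scale_Scale lie_eq.Scale_one)+
  moreover have "tetra_bracket (x + y) z = tetra_bracket x z + tetra_bracket y z"
    "tetra_bracket x (y + z) = tetra_bracket x y + tetra_bracket x z"
    "tetra_bracket (tetra_scale c x) y = tetra_scale c (tetra_bracket x y)"
    "tetra_bracket x (tetra_scale c y) = tetra_scale c (tetra_bracket x y)"
    "tetra_bracket x x = 0"
    "tetra_bracket x (tetra_bracket y z) + tetra_bracket y (tetra_bracket z x) +
       tetra_bracket z (tetra_bracket x y) = 0"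
    for x y z :: "'k tetrahedron" and c
    by (transfer, rule lie_eq.Bracket_Add_left lie_eq.Bracket_Add_right lie_eq.Bracket_Scale_left
          lie_eq.Bracket_Scale_right lie_eq.Bracket_self lie_eq.Jacobi)+
  ultimately show ?thesis
    by (simp add: lie_algebra_def lie_algebra_axioms_def Vector_Spaces.linear_iff)
qed

section \<open>The type of a module for the Onsager algebra\<close>

definition eigenvalues :: "('k \<Rightarrow> 'v \<Rightarrow> 'v) \<Rightarrow> ('v \<Rightarrow> 'v::zero) \<Rightarrow> 'k set" where
  "eigenvalues scaleV f = {c. \<exists>v. v \<noteq> 0 \<and> f v = scaleV c v}"

text \<open>On a finite-dimensional irreducible module both standard generators act diagonalizably,
  so this is not part of the definition. The scalars \<open>\<alpha>\<close> and \<open>\<alpha>'\<close> are uniquely determined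
  in characteristic \<open>0\<close>.\<close>

definition has_onsager_type ::
  "('k::field \<Rightarrow> 'v \<Rightarrow> 'v) \<Rightarrow> ('k onsager \<Rightarrow> 'v \<Rightarrow> 'v::zero) \<Rightarrow> 'k \<times> 'k \<Rightarrow> bool" where
  "has_onsager_type scaleV act = (\<lambda>(\<alpha>, \<alpha>').
     \<exists>d::nat.
       eigenvalues scaleV (act onsager_X) = {of_nat d - 2 * of_nat i + \<alpha> | i. i \<le> d} \<and>
       eigenvalues scaleV (act onsager_Y) = {of_nat d - 2 * of_nat i + \<alpha>' | i. i \<le> d})"

end

theory Submission
  imports Defs
begin

text \<open>
  Write \<open>A\<close>, \<open>B\<close> for the actions of \<open>X\<close>, \<open>Y\<close>. The Dolan--Grady relations say that \<open>B\<close> moves an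
  eigenvector of \<open>A\<close> only to the neighbouring eigenspaces, and vice versa; by irreducibility both are
  diagonalizable, and \<open>V\<close> is the direct sum of the intersections \<open>U\<^sub>i\<close> of the \<open>i\<close>-th member of
  the flag of \<open>B\<close> with the opposite member of the flag of \<open>A\<close> (the split decomposition of a
  tridiagonal pair). The operator acting on \<open>U\<^sub>i\<close> as the negative of the \<open>i\<close>-th eigenvalue
  satisfies the relations required of \<open>X\<^sub>1\<^sub>2\<close> with respect to \<open>A = X\<^sub>0\<^sub>1\<close> and \<open>B = X\<^sub>2\<^sub>3\<close>. Replacing
  \<open>A\<close>, \<open>B\<close> by \<open>\<plusminus>A\<close>, \<open>\<plusminus>B\<close> yields \<open>X\<^sub>0\<^sub>2\<close>, \<open>X\<^sub>1\<^sub>3\<close>, \<open>X\<^sub>0\<^sub>3\<close>.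

  If \<open>[A, E] = aE\<close> and \<open>[B, E] = bE\<close> with \<open>a \<noteq> 0\<close> or \<open>b \<noteq> 0\<close>, then \<open>E\<close> kills some
  eigenvector, because it shifts eigenvalues, and its kernel is a submodule, so \<open>E = 0\<close>. Applied to
  the difference of two candidates this gives uniqueness; applied to the defect of each remaining
  tetrahedron relation it gives that relation.
\<close>

section \<open>Endomorphisms and commutators\<close>

definition commutator :: "('v \<Rightarrow> 'v) \<Rightarrow> ('v \<Rightarrow> 'v) \<Rightarrow> 'v \<Rightarrow> 'v::ab_group_add" where
  "commutator f g = (\<lambda>v. f (g v) - g (f v))"

text \<open>Characteristic 0 enters through the sort of the scalars: it permits division by 4 and 8
  and keeps distinct integers distinct as eigenvalues.\<close>

locale char_0_space = vector_space scale
  for scale :: "'k::field_char_0 \<Rightarrow> 'v::ab_group_add \<Rightarrow> 'v"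
begin

abbreviation endo :: "('v \<Rightarrow> 'v) \<Rightarrow> bool" where
  "endo \<equiv> Vector_Spaces.linear scale scale"

lemma endo_iff: "endo f \<longleftrightarrow> (\<forall>x y. f (x + y) = f x + f y) \<and> (\<forall>c x. f (scale c x) = scale c (f x))"
  by (simp add: Vector_Spaces.linear_iff vector_space_axioms)

lemma endo_add: "endo f \<Longrightarrow> f (x + y) = f x + f y"
  and endo_scale: "endo f \<Longrightarrow> f (scale c x) = scale c (f x)"
  by (simp_all add: endo_iff)

lemma endo_0: "endo f \<Longrightarrow> f 0 = 0"
  using endo_scale[of f 0 0] by simp

lemma endo_minus: "endo f \<Longrightarrow> f (- x) = - f x"
  using endo_scale[of f "-1" x] by simp

lemma endo_diff: "endo f \<Longrightarrow> f (x - y) = f x - f y"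
  using endo_add[of f x "- y"] by (simp add: endo_minus)

lemmas endo_simps = endo_add endo_scale endo_0 endo_minus endo_diff

lemma endo_zero_fun: "endo (\<lambda>v. 0)"
  by (simp add: endo_iff)

lemma endo_uminus_fun: "endo f \<Longrightarrow> endo (\<lambda>v. - f v)"
  by (simp add: endo_iff)

lemma endo_plus_fun: "endo f \<Longrightarrow> endo g \<Longrightarrow> endo (\<lambda>v. f v + g v)"
  by (simp add: endo_iff scale_right_distrib)

lemma endo_minus_fun: "endo f \<Longrightarrow> endo g \<Longrightarrow> endo (\<lambda>v. f v - g v)"
  by (simp add: endo_iff scale_right_diff_distrib)

lemma endo_scale_fun: "endo f \<Longrightarrow> endo (\<lambda>v. scale c (f v))"
  by (simp add: endo_iff scale_right_distrib mult.commute)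

lemma endo_commutator: "endo f \<Longrightarrow> endo g \<Longrightarrow> endo (commutator f g)"
  by (simp add: endo_iff commutator_def scale_right_diff_distrib)

lemmas endo_intros = endo_zero_fun endo_uminus_fun endo_plus_fun endo_minus_fun endo_scale_fun
  endo_commutator

lemma subspace_endo_eq: "endo f \<Longrightarrow> endo g \<Longrightarrow> subspace {v. f v = g v}"
  by (auto simp: subspace_def endo_simps)

lemma subspace_endo_vimage: "endo f \<Longrightarrow> subspace W \<Longrightarrow> subspace {v. f v \<in> W}"
  by (auto simp: subspace_def endo_simps)

lemma scale_2: "scale 2 v = v + v"
  using scale_left_distrib[of 1 1 v] by simp

lemma scale_4: "scale 4 v = v + v + (v + v)"
  using scale_left_distrib[of 2 2 v] by (simp add: scale_2)

text \<open>\<open>adjacent f g\<close> and \<open>dolan_grady f g\<close> are the defining relations (ii) and (iii) of the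
  tetrahedron algebra, for \<open>f = X\<^sub>r\<^sub>s\<close> and \<open>g = X\<^sub>s\<^sub>t\<close> resp. \<open>g = X\<^sub>t\<^sub>u\<close>.\<close>

definition adjacent :: "('v \<Rightarrow> 'v) \<Rightarrow> ('v \<Rightarrow> 'v) \<Rightarrow> bool" where
  "adjacent f g \<longleftrightarrow> (\<forall>v. commutator f g v = scale 2 (f v) + scale 2 (g v))"

definition dolan_grady :: "('v \<Rightarrow> 'v) \<Rightarrow> ('v \<Rightarrow> 'v) \<Rightarrow> bool" where
  "dolan_grady f g \<longleftrightarrow>
     (\<forall>v. commutator f (commutator f (commutator f g)) v = scale 4 (commutator f g v))"

text \<open>A form without subtraction and scalars, suited to additive normalization.\<close>

lemma adjacent_iff: "adjacent f g \<longleftrightarrow> (\<forall>v. f (g v) = g (f v) + (f v + f v) + (g v + g v))"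
  by (auto simp: adjacent_def commutator_def scale_2 algebra_simps)

text \<open>For \<open>f\<close> as X_rs and \<open>g\<close> as X_st, the negatives are X_sr and
  X_ts, so this is relation (ii) along the reversed path t, s, r.\<close>

lemma adjacent_reverse:
  assumes "endo f" "endo g" "adjacent f g"
  shows "adjacent (\<lambda>v. - g v) (\<lambda>v. - f v)"
  using assms by (simp add: adjacent_iff endo_simps)

lemma dolan_grady_uminus:
  assumes "endo f" "endo g" "dolan_grady f g"
  shows "dolan_grady (\<lambda>v. - f v) g" "dolan_grady f (\<lambda>v. - g v)"
proof -
  have *: "commutator (\<lambda>v. - f v) h = (\<lambda>v. - commutator f h v)"
    "commutator f (\<lambda>v. - h v) = (\<lambda>v. - commutator f h v)" if "endo h" for h
    using that assms by (auto simp: commutator_def endo_simps)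
  show "dolan_grady (\<lambda>v. - f v) g" "dolan_grady f (\<lambda>v. - g v)"
    using assms by (auto simp: dolan_grady_def * endo_intros)
qed

lemma adjacentD: "adjacent f g \<Longrightarrow> f (g v) = g (f v) + (f v + f v) + (g v + g v)"
  by (simp add: adjacent_iff)

text \<open>At \<open>v\<close>, taking the commutator with \<open>A\<close> amounts to applying
  \<open>A - c\<close> to the value. The relation thus becomes the cubic t^3 = 4t, whose distinct
  roots -2, 0, 2 split \<open>B v\<close>.\<close>

lemma dolan_grady_eigenvector:
  assumes A: "endo A" and B: "endo B" and DG: "dolan_grady A B" and v: "A v = scale c v"
  obtains x y z where "B v = x + y + z" "A x = scale (c - 2) x" "A y = scale c y"
    "A z = scale (c + 2) z"
proof -
  define D where "D x = A x - scale c x" for x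
  have D: "endo D"
    unfolding D_def [abs_def] using A
    by (auto simp: endo_iff algebra_simps)
  have AD: "A x = D x + scale c x" for x
    by (simp add: D_def)
  have com: "commutator A f v = D (f v)" if "endo f" for f
    using that by (simp add: commutator_def D_def v endo_simps)
  have "commutator A (commutator A (commutator A B)) v = scale 4 (commutator A B v)"
    using DG by (simp add: dolan_grady_def)
  then have D3: "D (D (D (B v))) = scale 4 (D (B v))"
    using A B by (simp add: com endo_commutator)
  \<comment> \<open>\<open>D\<^sup>3 = 4D\<close> on \<open>B v\<close>; these are its components in the eigenspaces of \<open>D\<close> for \<open>-2\<close>, \<open>0\<close>, \<open>2\<close>.\<close>
  define x where "x = scale (1/8) (D (D (B v)) - scale 2 (D (B v)))"
  define z where "z = scale (1/8) (D (D (B v)) + scale 2 (D (B v)))"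
  define y where "y = B v - scale (1/4) (D (D (B v)))"
  have "D x = scale (1/8) (scale 4 (D (B v)) - scale 2 (D (D (B v))))"
    using D by (simp add: x_def endo_simps D3)
  also have "\<dots> = scale (- 2) x"
    by (simp add: x_def scale_right_diff_distrib)
  finally have Dx: "D x = scale (- 2) x" .
  have "D z = scale (1/8) (scale 4 (D (B v)) + scale 2 (D (D (B v))))"
    using D by (simp add: z_def endo_simps D3)
  also have "\<dots> = scale 2 z"
    by (simp add: z_def scale_right_distrib)
  finally have Dz: "D z = scale 2 z" .
  have Dy: "D y = 0"
    using D by (simp add: y_def endo_simps D3)
  have "x + z = scale (1/8) (scale 2 (D (D (B v))))"
    by (simp only: x_def z_def scale_right_distrib[symmetric] scale_2) (simp add: algebra_simps)
  also have "\<dots> = scale (1/4) (D (D (B v)))"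
    by simp
  finally have "B v = x + y + z"
    by (simp add: y_def algebra_simps)
  moreover have "A x = scale (c - 2) x"
    unfolding AD Dx by (simp add: scale_left_diff_distrib)
  moreover have "A y = scale c y"
    unfolding AD Dy by simp
  moreover have "A z = scale (c + 2) z"
    unfolding AD Dz by (simp add: scale_left_distrib)
  ultimately show thesis
    using that by blast
qed

end

section \<open>Irreducible pairs of operators satisfying the Dolan--Grady relations\<close>

text \<open>The module is reduced to two operators, so that every result can be reused after
  exchanging them or changing their signs.\<close>

locale onsager_pair = char_0_space scale
  for scale :: "'k::field_char_0 \<Rightarrow> 'v::ab_group_add \<Rightarrow> 'v" +
  fixes A B :: "'v \<Rightarrow> 'v" and d :: nat
  assumes A: "endo A" and B: "endo B"
    and dolan_grady_AB: "dolan_grady A B" and dolan_grady_BA: "dolan_grady B A"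
    and eigenvalues_A: "eigenvalues scale A = {of_nat d - 2 * of_nat i | i. i \<le> d}"
    and eigenvalues_B: "eigenvalues scale B = {of_nat d - 2 * of_nat i | i. i \<le> d}"
    and irreducible_AB: "\<lbrakk>subspace W; \<And>w. w \<in> W \<Longrightarrow> A w \<in> W; \<And>w. w \<in> W \<Longrightarrow> B w \<in> W\<rbrakk>
      \<Longrightarrow> W = {0} \<or> W = UNIV"
begin

section \<open>Symmetries of the pair: exchange and sign changes\<close>

lemma swap: "onsager_pair scale B A d"
proof (intro onsager_pair.intro onsager_pair_axioms.intro)
  show "W = {0} \<or> W = UNIV"
    if "subspace W" "\<And>w. w \<in> W \<Longrightarrow> B w \<in> W" "\<And>w. w \<in> W \<Longrightarrow> A w \<in> W" for W
    using that(1,3,2) by (rule irreducible_AB)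
qed (fact char_0_space_axioms A B dolan_grady_AB dolan_grady_BA eigenvalues_A eigenvalues_B)+

text \<open>Type (0,0) makes the spectrum symmetric about 0; negation is the reindexing of
  \<open>i\<close> to \<open>d - i\<close>.\<close>

lemma eigenvalues_uminus:
  assumes "eigenvalues scale f = {of_nat d - 2 * of_nat i | i. i \<le> d}"
  shows "eigenvalues scale (\<lambda>v. - f v) = {of_nat d - 2 * of_nat i | i. i \<le> d}"
proof -
  have "c \<in> eigenvalues scale (\<lambda>v. - f v) \<longleftrightarrow> - c \<in> eigenvalues scale f" for c
    by (auto simp: eigenvalues_def) (metis minus_minus)+
  moreover have "- c \<in> {of_nat d - 2 * of_nat i | i. i \<le> d} \<longleftrightarrow>
      c \<in> {of_nat d - 2 * of_nat i | i. i \<le> d}" for c :: 'k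
  proof -
    have *: "- c \<in> {of_nat d - 2 * of_nat i | i. i \<le> d}"
      if "c \<in> {of_nat d - 2 * of_nat i | i. i \<le> d}" for c :: 'k
    proof -
      from that obtain i where "i \<le> d" "c = of_nat d - 2 * of_nat i" by blast
      then have "d - i \<le> d \<and> - c = of_nat d - 2 * of_nat (d - i)"
        by (simp add: of_nat_diff)
      then show ?thesis by blast
    qed
    show ?thesis using *[of c] *[of "- c"] by auto
  qed
  ultimately show ?thesis using assms by blast
qed

text \<open>Each Dolan--Grady relation only changes by an overall sign when one operator is negated.
  On indices, negating \<open>A\<close> exchanges 0 and 1, and negating \<open>B\<close> exchanges 2
  and 3.\<close>

lemma uminus_left: "onsager_pair scale (\<lambda>v. - A v) B d"
proof (intro onsager_pair.intro onsager_pair_axioms.intro)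
  show "W = {0} \<or> W = UNIV"
    if W: "subspace W" and "\<And>w. w \<in> W \<Longrightarrow> - A w \<in> W" and BW: "\<And>w. w \<in> W \<Longrightarrow> B w \<in> W" for W
  proof (rule irreducible_AB[OF W _ BW])
    show "A w \<in> W" if "w \<in> W" for w
      using \<open>w \<in> W \<Longrightarrow> - A w \<in> W\<close>[OF that] subspace_neg[OF W] by force
  qed
qed (fact char_0_space_axioms B endo_uminus_fun[OF A] dolan_grady_uminus[OF A B dolan_grady_AB]
    dolan_grady_uminus[OF B A dolan_grady_BA] eigenvalues_uminus[OF eigenvalues_A] eigenvalues_B)+

lemma uminus_right: "onsager_pair scale A (\<lambda>v. - B v) d"
  using onsager_pair.swap[OF onsager_pair.uminus_left[OF swap]] .

lemma uminus_both: "onsager_pair scale (\<lambda>v. - A v) (\<lambda>v. - B v) d"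
  using onsager_pair.uminus_right[OF uminus_left] .

section \<open>The spectrum of \<open>A\<close>, indexed by integers in increasing order\<close>

definition \<theta> :: "int \<Rightarrow> 'k" where "\<theta> i = of_int (2 * i - int d)"

lemma \<theta>_Suc: "\<theta> (i + 1) = \<theta> i + 2" and \<theta>_pred: "\<theta> (i - 1) = \<theta> i - 2"
  by (simp_all add: \<theta>_def algebra_simps)

lemma \<theta>_inj: "\<theta> i = \<theta> j \<longleftrightarrow> i = j"
  by (simp add: \<theta>_def)

lemma eigenvalues_A_iff: "c \<in> eigenvalues scale A \<longleftrightarrow> (\<exists>i\<in>{0..int d}. c = \<theta> i)"
proof
  assume "c \<in> eigenvalues scale A"
  then obtain i where "i \<le> d" "c = of_nat d - 2 * of_nat i"
    unfolding eigenvalues_A by blast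
  then show "\<exists>i\<in>{0..int d}. c = \<theta> i"
    \<comment> \<open>The locale lists the eigenvalues in decreasing order while
      \<open>\<theta>\<close> increases, hence the reversed index.\<close>
    by (intro bexI[of _ "int (d - i)"]) (auto simp: \<theta>_def of_nat_diff)
next
  assume "\<exists>i\<in>{0..int d}. c = \<theta> i"
  then obtain i where "i \<in> {0..int d}" "c = \<theta> i" by blast
  then show "c \<in> eigenvalues scale A"
    unfolding eigenvalues_A
    by (intro CollectI exI[of _ "d - nat i"]) (auto simp: \<theta>_def of_nat_diff)
qed

lemma eigenvector_exists:
  assumes "i \<in> {0..int d}"
  obtains v where "v \<noteq> 0" "A v = scale (\<theta> i) v"
proof -
  have "\<theta> i \<in> eigenvalues scale A"
    using assms unfolding eigenvalues_A_iff by blast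
  then show thesis using that unfolding eigenvalues_def by blast
qed

lemma finite_eigenvalues_A: "finite (eigenvalues scale A)"
  unfolding eigenvalues_A by simp

text \<open>The operator \<open>E\<close> shifts the eigenvalues of \<open>A\<close> by \<open>a\<close>, so it is not injective, and its
  kernel is invariant under \<open>A\<close> and \<open>B\<close>.\<close>

lemma commutator_eigenvector_zero:
  assumes E: "endo E" and a: "a \<noteq> 0"
    and AE: "\<And>v. commutator A E v = scale a (E v)"
    and BE: "\<And>v. commutator B E v = scale b (E v)"
  shows "E v = 0"
proof -
  obtain c w where w: "w \<noteq> 0" "A w = scale c w"
    by (rule eigenvector_exists[of 0]) simp_all
  define u where "u n = (E ^^ n) w" for n
  have Au: "A (u n) = scale (c + of_nat n * a) (u n)" for n
  proof (induction n)
    case 0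
    then show ?case using w by (simp add: u_def)
  next
    case (Suc n)
    have "A (E (u n)) = scale a (E (u n)) + E (A (u n))"
      using AE[of "u n"] by (simp add: commutator_def algebra_simps)
    then show ?case
      using Suc E by (simp add: u_def endo_simps algebra_simps)
  qed
  \<comment> \<open>Otherwise the pairwise distinct scalars \<open>c + of_nat n * a\<close> would
    all be eigenvalues of \<open>A\<close>. The last nonzero \<open>u m\<close> is then a nonzero
    vector in the kernel of \<open>E\<close>.\<close>
  have "\<exists>n. u n = 0"
  proof (rule ccontr)
    assume "\<nexists>n. u n = 0"
    then have "range (\<lambda>n. c + of_nat n * a) \<subseteq> eigenvalues scale A"
      using Au by (auto simp: eigenvalues_def)
    then have "finite (range (\<lambda>n. c + of_nat n * a))"
      using finite_eigenvalues_A finite_subset by blast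
    moreover have "inj (\<lambda>n. c + of_nat n * a)"
      using a by (auto simp: inj_def)
    ultimately show False
      using finite_imageD infinite_UNIV_nat by blast
  qed
  then obtain n where "u n = 0" "\<And>m. m < n \<Longrightarrow> u m \<noteq> 0"
    using exists_least_iff[of "\<lambda>n. u n = 0"] by blast
  moreover have "u 0 \<noteq> 0" using w by (simp add: u_def)
  ultimately obtain m where "u m \<noteq> 0" "E (u m) = 0"
    by (cases n) (auto simp: u_def)
  moreover have "{v. E v = 0} = {0} \<or> {v. E v = 0} = UNIV"
  proof (rule irreducible_AB)
    show "subspace {v. E v = 0}"
      using subspace_endo_eq[OF E endo_zero_fun] .
    show "A v \<in> {v. E v = 0}" "B v \<in> {v. E v = 0}" if "v \<in> {v. E v = 0}" for v
      using that AE[of v] BE[of v] A B by (auto simp: commutator_def endo_simps)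
  qed
  ultimately show ?thesis by auto
qed

text \<open>In the difference \<open>E\<close> of two solutions the terms in \<open>A\<close> and
  \<open>B\<close> cancel, leaving [A, E] = 2E and [B, E] = -2E.\<close>

lemma adjacent_unique:
  assumes "endo P" "adjacent A P" "adjacent P B"
    and "endo P'" "adjacent A P'" "adjacent P' B"
  shows "P = P'"
proof
  fix v
  have "P v - P' v = 0"
  proof (rule commutator_eigenvector_zero[of "\<lambda>v. P v - P' v" 2 "-2"])
    show "commutator A (\<lambda>v. P v - P' v) v = scale 2 (P v - P' v)" for v
      using assms(2,5)[THEN adjacentD, of v] A
      by (simp add: commutator_def scale_2 endo_simps algebra_simps)
    show "commutator B (\<lambda>v. P v - P' v) v = scale (- 2) (P v - P' v)" for v
      using assms(3,6)[THEN adjacentD, of v] B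
      by (simp add: commutator_def scale_2 endo_simps algebra_simps)
  qed (use assms endo_intros in auto)
  then show "P v = P' v" by simp
qed

end

text \<open>With \<open>A = X\<^sub>0\<^sub>1\<close>, \<open>B = X\<^sub>2\<^sub>3\<close>, \<open>P = X\<^sub>1\<^sub>2\<close>, \<open>Q = X\<^sub>0\<^sub>2\<close> this is relation (ii) for \<open>[X\<^sub>1\<^sub>2, X\<^sub>2\<^sub>0]\<close>.\<close>

lemma (in onsager_pair) adjacent_third:
  assumes P: "endo P" and Q: "endo Q"
    and AP: "adjacent A P" and PB: "adjacent P B"
    and AQ: "adjacent (\<lambda>v. - A v) Q" and QB: "adjacent Q B"
  shows "adjacent P (\<lambda>v. - Q v)"
proof -
  \<comment> \<open>The defect [P, Q] + 2P - 2Q of the claimed relation.\<close>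
  define E where "E v = P (Q v) - Q (P v) + (P v + P v) - (Q v + Q v)" for v
  have APv: "A (P v) = P (A v) + (A v + A v) + (P v + P v)" for v
    using AP by (rule adjacentD)
  have AQv: "A (Q v) = Q (A v) + (A v + A v) - (Q v + Q v)" for v
    using adjacentD[OF AQ, of v] Q by (simp add: endo_simps algebra_simps)
  have BPv: "B (P v) = P (B v) - (B v + B v) - (P v + P v)" for v
    using adjacentD[OF PB, of v] by (simp add: algebra_simps)
  have BQv: "B (Q v) = Q (B v) - (B v + B v) - (Q v + Q v)" for v
    using adjacentD[OF QB, of v] by (simp add: algebra_simps)
  interpret BA: onsager_pair scale B A d by (rule swap)
  have "E v = 0" for v
  \<comment> \<open>\<open>E\<close> commutes with \<open>A\<close>; the nonzero shift belongs to
    \<open>B\<close>, hence the exchanged pair.\<close>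
  proof (rule BA.commutator_eigenvector_zero[of E "-4" 0])
    show "endo E"
      unfolding E_def [abs_def] using P Q by (auto simp: endo_iff algebra_simps)
    show "commutator B E v = scale (- 4) (E v)" for v
      by (simp add: commutator_def E_def scale_4 endo_simps[OF P] endo_simps[OF Q]
          endo_simps[OF B] BPv BQv algebra_simps)
    show "commutator A E v = scale 0 (E v)" for v
      by (simp add: commutator_def E_def scale_4 endo_simps[OF P] endo_simps[OF Q]
          endo_simps[OF A] APv AQv algebra_simps)
  qed simp
  then show ?thesis
    using P Q by (simp add: adjacent_iff E_def endo_simps algebra_simps)
qed

section \<open>Commutator calculus for relation (iii)\<close>

lemma (in char_0_space) scale_double:
  "scale (numeral (num.Bit0 n)) v = scale (numeral n) v + scale (numeral n) v"
  by (simp only: scale_left_distrib[symmetric] numeral_Bit0)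

lemma (in char_0_space) commutator_linear:
  assumes "endo h"
  shows "commutator (\<lambda>v. f v + g v) h = (\<lambda>v. commutator f h v + commutator g h v)"
    and "commutator (\<lambda>v. f v - g v) h = (\<lambda>v. commutator f h v - commutator g h v)"
    and "commutator (\<lambda>v. scale c (f v)) h = (\<lambda>v. scale c (commutator f h v))"
    and "commutator h (\<lambda>v. f v + g v) = (\<lambda>v. commutator h f v + commutator h g v)"
    and "commutator h (\<lambda>v. f v - g v) = (\<lambda>v. commutator h f v - commutator h g v)"
    and "commutator h (\<lambda>v. scale c (f v)) = (\<lambda>v. scale c (commutator h f v))"
  using assms by (auto simp: commutator_def endo_simps algebra_simps)

text \<open>The Jacobi identity, read as saying that the commutator with \<open>f\<close> is a
  derivation.\<close>

lemma (in char_0_space) commutator_derivation: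
  assumes "endo f" "endo g" "endo h"
  shows "commutator f (commutator g h) =
    (\<lambda>v. commutator (commutator f g) h v + commutator g (commutator f h) v)"
  using assms by (auto simp: commutator_def endo_simps algebra_simps)

text \<open>The derivation rule gives the commutators of \<open>D\<close> with \<open>C\<close>,
  \<open>C'\<close> and \<open>C''\<close> in turn; in the defect \<open>F\<close> the multiples of
  \<open>Q + R\<close> cancel. The sign \<open>e\<close> lets \<open>D\<close> stand for either
  \<open>A\<close> or \<open>B\<close>.\<close>

lemma (in char_0_space) commutator_dolan_grady_defect:
  assumes D: "endo D" and Q: "endo Q" and R: "endo R" and e: "e = 1 \<or> e = -1"
    and DQ: "commutator D Q = (\<lambda>v. scale e (scale 2 (D v)) - scale 2 (Q v))"
    and DR: "commutator D R = (\<lambda>v. scale e (scale 2 (D v)) + scale 2 (R v))"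
  defines "C \<equiv> commutator Q R"
  defines "F \<equiv> \<lambda>v. commutator Q (commutator Q C) v - scale 4 (C v)"
  shows "commutator D F v = scale (- 4) (F v)"
proof -
  define C' where "C' = commutator Q C"
  define C'' where "C'' = commutator Q C'"
  have C: "endo C" and C': "endo C'" and C'': "endo C''"
    by (simp_all add: C_def C'_def C''_def endo_commutator Q R)
  note lin = commutator_linear[OF D] commutator_linear[OF Q] commutator_linear[OF R]
    commutator_linear[OF C] commutator_linear[OF C'] commutator_linear[OF C'']
  have QD: "commutator Q D = (\<lambda>v. scale 2 (Q v) - scale e (scale 2 (D v)))"
  proof
    fix v
    have "commutator Q D v = - commutator D Q v" by (simp add: commutator_def)
    then show "commutator Q D v = scale 2 (Q v) - scale e (scale 2 (D v))" by (simp add: DQ)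
  qed
  have QQ: "commutator Q Q = (\<lambda>v. 0)"
    by (simp add: commutator_def)
  have DC: "commutator D C = (\<lambda>v. scale e (scale 4 (Q v + R v)))"
    unfolding C_def commutator_derivation[OF D Q R] DQ DR
    using e by (simp only: lin DR QD C_def[symmetric])
      (auto simp: fun_eq_iff scale_double algebra_simps)
  have DC': "commutator D C' =
      (\<lambda>v. scale 8 (Q v + R v) - scale 2 (C' v) + scale e (scale 4 (C v)))"
    unfolding C'_def commutator_derivation[OF D Q C] DQ DC
    using e by (simp only: lin DC QQ C'_def[symmetric] C_def[symmetric])
      (auto simp: fun_eq_iff scale_double algebra_simps)
  have DC'': "commutator D C'' =
      (\<lambda>v. scale e (scale 16 (Q v + R v)) + scale 16 (C v) - scale 4 (C'' v))"
    unfolding C''_def commutator_derivation[OF D Q C'] DQ DC'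
    using e by (simp only: lin DC' QQ C''_def[symmetric] C'_def[symmetric] C_def[symmetric])
      (auto simp: fun_eq_iff scale_double algebra_simps)
  have "commutator D (\<lambda>v. C'' v - scale 4 (C v)) v = scale (- 4) (C'' v - scale 4 (C v))"
    using e by (simp only: lin DC DC'')
      (auto simp: fun_eq_iff scale_double algebra_simps)
  then show ?thesis by (simp add: F_def C'_def C''_def)
qed

text \<open>With \<open>Q = X\<^sub>0\<^sub>2\<close> and \<open>R = X\<^sub>1\<^sub>3\<close> this is relation (iii).\<close>

lemma (in onsager_pair) adjacent_dolan_grady:
  assumes Q: "endo Q" and R: "endo R"
    and AQ: "adjacent (\<lambda>v. - A v) Q" and QB: "adjacent Q B"
    and AR: "adjacent A R" and RB: "adjacent R (\<lambda>v. - B v)"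
  shows "dolan_grady Q R"
proof -
  define F where "F v = commutator Q (commutator Q (commutator Q R)) v - scale 4 (commutator Q R v)" for v
  have "F v = 0" for v
  \<comment> \<open>The defect is shifted by -4 under both operators: \<open>e\<close> is 1 for
    \<open>A\<close> and -1 for \<open>B\<close>.\<close>
  proof (rule commutator_eigenvector_zero[of F "-4" "-4"])
    show "endo F"
      unfolding F_def [abs_def] by (intro endo_intros Q R)
    show "commutator A F v = scale (- 4) (F v)" for v
      unfolding F_def [abs_def]
    proof (rule commutator_dolan_grady_defect[OF A Q R, of 1])
      show "commutator A Q = (\<lambda>v. scale 1 (scale 2 (A v)) - scale 2 (Q v))"
        using adjacentD[OF AQ] Q by (auto simp: commutator_def scale_2 endo_simps algebra_simps)
      show "commutator A R = (\<lambda>v. scale 1 (scale 2 (A v)) + scale 2 (R v))"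
        using adjacentD[OF AR] by (auto simp: commutator_def scale_2 algebra_simps)
    qed simp
    show "commutator B F v = scale (- 4) (F v)" for v
      unfolding F_def [abs_def]
    proof (rule commutator_dolan_grady_defect[OF B Q R, of "-1"])
      show "commutator B Q = (\<lambda>v. scale (- 1) (scale 2 (B v)) - scale 2 (Q v))"
        using adjacentD[OF QB] by (auto simp: commutator_def scale_2 algebra_simps)
      show "commutator B R = (\<lambda>v. scale (- 1) (scale 2 (B v)) + scale 2 (R v))"
        using adjacentD[OF RB] R by (auto simp: commutator_def scale_2 endo_simps algebra_simps)
    qed simp
  qed simp
  then show ?thesis
    by (simp add: dolan_grady_def F_def)
qed

section \<open>The split decomposition\<close>

context onsager_pair
begin

text \<open>Diagonalizability: by the Dolan--Grady relation \<open>B\<close> sends an eigenvector of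
  \<open>A\<close> to a sum of eigenvectors, so their span is a nonzero invariant subspace.\<close>

lemma eigenvectors_span: "span {v. \<exists>c. A v = scale c v} = UNIV"
proof -
  let ?S = "{v. \<exists>c. A v = scale c v}"
  have "A w \<in> span ?S" if "w \<in> span ?S" for w
    using that
  proof (induction rule: span_induct)
    case base
    show ?case by (rule subspace_endo_vimage[OF A subspace_span])
  next
    case (step v)
    then obtain c where "A v = scale c v" by blast
    then show ?case using span_scale[OF span_base[OF step]] by simp
  qed
  moreover have "B w \<in> span ?S" if "w \<in> span ?S" for w
    using that
  proof (induction rule: span_induct)
    case base
    show ?case by (rule subspace_endo_vimage[OF B subspace_span])
  next
    case (step v)
    then obtain c where "A v = scale c v" by blast
    then obtain x y z where "B v = x + y + z" "A x = scale (c - 2) x" "A y = scale c y"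
        "A z = scale (c + 2) z"
      using dolan_grady_eigenvector[OF A B dolan_grady_AB] by metis
    moreover from this(2-4) have "x \<in> ?S" "y \<in> ?S" "z \<in> ?S" by blast+
    ultimately show ?case by (auto intro: span_add span_base)
  qed
  moreover obtain v where "v \<noteq> 0" "v \<in> ?S"
    by (rule eigenvector_exists[of 0]) simp_all
  ultimately show ?thesis
    using irreducible_AB[of "span ?S"] span_base[of v ?S] by auto
qed

text \<open>The indices range over all integers; those outside \<open>{0..d}\<close> contribute no eigenvectors of
  \<open>A\<close> or \<open>B\<close>.\<close>

definition eigenspan :: "('v \<Rightarrow> 'v) \<Rightarrow> int set \<Rightarrow> 'v set" where
  "eigenspan f J = span {v. \<exists>k\<in>J. f v = scale (\<theta> k) v}"

section \<open>Spans of eigenspaces under the two operators\<close>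

lemma subspace_eigenspan: "subspace (eigenspan f J)"
  by (simp add: eigenspan_def)

lemma eigenspan_mono: "J \<subseteq> J' \<Longrightarrow> eigenspan f J \<subseteq> eigenspan f J'"
  unfolding eigenspan_def by (rule span_mono) blast

text \<open>Subtracting \<open>\<theta> j\<close> from \<open>f\<close> kills the eigenvectors of
  index \<open>j\<close> and rescales the others.\<close>

lemma eigenspan_shift:
  assumes f: "endo f" and v: "v \<in> eigenspan f J"
  shows "f v - scale (\<theta> j) v \<in> eigenspan f (J - {j})"
  using v unfolding eigenspan_def
proof (induction rule: span_induct)
  case base
  have "endo (\<lambda>v. f v - scale (\<theta> j) v)"
    using f by (auto simp: endo_iff algebra_simps)
  then show ?case by (rule subspace_endo_vimage) simp
next
  case (step v)
  then obtain k where k: "k \<in> J" "f v = scale (\<theta> k) v" by blast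
  show ?case
  proof (cases "k = j")
    case True
    then show ?thesis using k by (simp add: span_zero)
  next
    case False
    then have "v \<in> span {v. \<exists>k\<in>J - {j}. f v = scale (\<theta> k) v}"
      using k by (intro span_base) blast
    then show ?thesis
      using k by (simp add: span_scale scale_left_diff_distrib[symmetric])
  qed
qed

text \<open>The tridiagonal shape of \<open>B\<close> relative to \<open>A\<close>, with
  \<open>J'\<close> left free so that half-lines of indices are covered directly.\<close>

lemma eigenspan_A_B:
  assumes v: "v \<in> eigenspan A J"
    and J: "\<And>k. k \<in> J \<Longrightarrow> k \<in> J' \<and> k + 1 \<in> J' \<and> k - 1 \<in> J'"
  shows "B v \<in> eigenspan A J'"
  using v unfolding eigenspan_def
proof (induction rule: span_induct)
  case base
  show ?case by (rule subspace_endo_vimage[OF B subspace_span])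
next
  case (step v)
  then obtain k where k: "k \<in> J" "A v = scale (\<theta> k) v" by blast
  obtain x y z where "B v = x + y + z" "A x = scale (\<theta> (k - 1)) x" "A y = scale (\<theta> k) y"
      "A z = scale (\<theta> (k + 1)) z"
    using dolan_grady_eigenvector[OF A B dolan_grady_AB k(2)] unfolding \<theta>_Suc \<theta>_pred by metis
  moreover from this(2-4) have "x \<in> {v. \<exists>k\<in>J'. A v = scale (\<theta> k) v}"
      "y \<in> {v. \<exists>k\<in>J'. A v = scale (\<theta> k) v}" "z \<in> {v. \<exists>k\<in>J'. A v = scale (\<theta> k) v}"
    using J[OF k(1)] by blast+
  ultimately show ?case
    by (simp add: span_add span_base)
qed

lemma eigenspan_A_Int: "eigenspan A J = eigenspan A (J \<inter> {0..int d})"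
proof
  show "eigenspan A J \<subseteq> eigenspan A (J \<inter> {0..int d})"
    unfolding eigenspan_def
  proof (rule span_minimal, rule subsetI)
    fix v assume "v \<in> {v. \<exists>k\<in>J. A v = scale (\<theta> k) v}"
    then obtain k where k: "k \<in> J" "A v = scale (\<theta> k) v" by blast
    show "v \<in> span {v. \<exists>k\<in>J \<inter> {0..int d}. A v = scale (\<theta> k) v}"
    proof (cases "v = 0")
      case False
      then have "\<theta> k \<in> eigenvalues scale A" using k by (auto simp: eigenvalues_def)
      then have "k \<in> {0..int d}" unfolding eigenvalues_A_iff \<theta>_inj by blast
      then show ?thesis using k by (intro span_base) blast
    qed (simp add: span_zero)
  qed simp
qed (rule eigenspan_mono, simp)

lemma eigenspan_A_empty: "J \<inter> {0..int d} = {} \<Longrightarrow> eigenspan A J = {0}"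
  by (subst eigenspan_A_Int) (simp add: eigenspan_def)

lemma eigenspan_A_UNIV: "{0..int d} \<subseteq> J \<Longrightarrow> eigenspan A J = UNIV"
proof -
  have "{v. \<exists>c. A v = scale c v} \<subseteq> eigenspan A {0..int d}"
  proof
    fix v assume "v \<in> {v. \<exists>c. A v = scale c v}"
    then obtain c where c: "A v = scale c v" by blast
    show "v \<in> eigenspan A {0..int d}"
    proof (cases "v = 0")
      case False
      then have "c \<in> eigenvalues scale A" using c by (auto simp: eigenvalues_def)
      then show ?thesis using c unfolding eigenvalues_A_iff eigenspan_def
        by (intro span_base) blast
    qed (simp add: eigenspan_def span_zero)
  qed
  then have "UNIV \<subseteq> eigenspan A {0..int d}"
    using span_minimal[OF _ subspace_eigenspan] eigenvectors_span by metis
  then show "eigenspan A J = UNIV" if "{0..int d} \<subseteq> J"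
    using eigenspan_mono[OF that, of A] by blast
qed

text \<open>Independence of eigenspaces: subtracting \<open>\<theta> j\<close> from \<open>A\<close>
  removes \<open>j\<close> from the index set and multiplies \<open>v\<close> by the nonzero scalar
  \<open>\<theta> k - \<theta> j\<close>.\<close>

lemma eigenvector_eigenspan_zero:
  assumes "v \<in> eigenspan A J" "A v = scale (\<theta> k) v" "k \<notin> J"
  shows "v = 0"
proof -
  have "v = 0" if "finite J" "v \<in> eigenspan A J" "k \<notin> J" for J
    using that
  proof (induction J rule: finite_induct)
    case empty
    then show ?case by (simp add: eigenspan_def)
  next
    case (insert j J)
    have "A v - scale (\<theta> j) v \<in> eigenspan A J"
      using eigenspan_shift[OF A insert.prems(1), of j] insert.hyps by simp
    then have "scale (\<theta> k - \<theta> j) v \<in> eigenspan A J"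
      using assms(2) by (simp add: scale_left_diff_distrib)
    then have "scale (1 / (\<theta> k - \<theta> j)) (scale (\<theta> k - \<theta> j) v) \<in> eigenspan A J"
      by (rule subspace_scale[OF subspace_eigenspan])
    moreover have "\<theta> k - \<theta> j \<noteq> 0"
      using insert.prems by (auto simp: \<theta>_inj)
    ultimately show ?case using insert by simp
  qed
  \<comment> \<open>The induction needs a finite set; only indices in \<open>{0..int d}\<close>
    contribute.\<close>
  from this[of "J \<inter> {0..int d}"] show ?thesis
    using assms eigenspan_A_Int[of J] by auto
qed

text \<open>For \<open>j = i\<close> this is the i-th component of the split decomposition. Two
  separate indices also give access to the parallel diagonals \<open>j = i + r\<close>.\<close>

definition split_space :: "int \<Rightarrow> int \<Rightarrow> 'v set" where
  "split_space i j = eigenspan B {..i} \<inter> eigenspan A {j..}"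

lemma subspace_split_space: "subspace (split_space i j)"
  by (simp add: split_space_def subspace_inter subspace_eigenspan)

text \<open>Subtracting \<open>\<theta> j\<close> removes the lowest eigenspace of \<open>A\<close>,
  and by tridiagonality \<open>A\<close> extends the flag of \<open>B\<close> by at most one step.
  The lowering by \<open>B\<close> is dual.\<close>

lemma split_space_A:
  assumes v: "v \<in> split_space i j"
  shows "A v - scale (\<theta> j) v \<in> split_space (i + 1) (j + 1)"
proof -
  interpret BA: onsager_pair scale B A d by (rule swap)
  have "A v \<in> eigenspan B {..i + 1}"
    by (rule BA.eigenspan_A_B[of v "{..i}"]) (use v in \<open>auto simp: split_space_def\<close>)
  moreover have "v \<in> eigenspan B {..i + 1}"
    using v eigenspan_mono[of "{..i}" "{..i + 1}" B] by (auto simp: split_space_def)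
  ultimately have "A v - scale (\<theta> j) v \<in> eigenspan B {..i + 1}"
    by (intro subspace_diff subspace_scale subspace_eigenspan)
  moreover have "{j..} - {j} = {j + 1..}" by auto
  ultimately show ?thesis
    using v eigenspan_shift[OF A, of v "{j..}" j] by (simp add: split_space_def)
qed

lemma split_space_B:
  assumes v: "v \<in> split_space i j"
  shows "B v - scale (\<theta> i) v \<in> split_space (i - 1) (j - 1)"
proof -
  have "B v \<in> eigenspan A {j - 1..}"
    by (rule eigenspan_A_B[of v "{j..}"]) (use v in \<open>auto simp: split_space_def\<close>)
  moreover have "v \<in> eigenspan A {j - 1..}"
    using v eigenspan_mono[of "{j..}" "{j - 1..}" A] by (auto simp: split_space_def)
  ultimately have "B v - scale (\<theta> i) v \<in> eigenspan A {j - 1..}"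
    by (intro subspace_diff subspace_scale subspace_eigenspan)
  moreover have "{..i} - {i} = {..i - 1}" by auto
  ultimately show ?thesis
    using v eigenspan_shift[OF B, of v "{..i}" i] by (simp add: split_space_def)
qed

text \<open>Raising by \<open>A\<close> and lowering by \<open>B\<close> stay on the diagonal of
  offset \<open>r\<close>, so its span is invariant. Offset 1 will yield directness, offset 0
  exhaustion.\<close>

lemma split_space_sum:
  "span (\<Union>i. split_space i (i + r)) = {0} \<or> span (\<Union>i. split_space i (i + r)) = UNIV"
proof (rule irreducible_AB)
  let ?S = "\<Union>i. split_space i (i + r)"
  show "subspace (span ?S)" by simp
  show "A w \<in> span ?S" if "w \<in> span ?S" for w
    using that
  proof (induction rule: span_induct)
    case base
    show ?case by (rule subspace_endo_vimage[OF A subspace_span])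
  next
    case (step v)
    then obtain i where i: "v \<in> split_space i (i + r)" by blast
    have "A v - scale (\<theta> (i + r)) v \<in> split_space (i + 1) (i + 1 + r)"
      using split_space_A[OF i] by (simp add: add.assoc add.commute[of r 1])
    then have n: "A v - scale (\<theta> (i + r)) v \<in> span ?S"
      by (intro span_base) blast
    show ?case
      using span_add[OF n span_scale[OF span_base[OF step]], of "\<theta> (i + r)"]
      by (simp only: diff_add_cancel)
  qed
  show "B w \<in> span ?S" if "w \<in> span ?S" for w
    using that
  proof (induction rule: span_induct)
    case base
    show ?case by (rule subspace_endo_vimage[OF B subspace_span])
  next
    case (step v)
    then obtain i where i: "v \<in> split_space i (i + r)" by blast
    have "B v - scale (\<theta> i) v \<in> split_space (i - 1) (i - 1 + r)"
      using split_space_B[OF i] by (simp add: algebra_simps)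
    then have n: "B v - scale (\<theta> i) v \<in> span ?S"
      by (intro span_base) blast
    show ?case
      using span_add[OF n span_scale[OF span_base[OF step]], of "\<theta> i"]
      by (simp only: diff_add_cancel)
  qed
qed

text \<open>The diagonal of offset 1 lies above index 0 of \<open>A\<close>: for negative
  \<open>i\<close> the flag of \<open>B\<close> is zero. Its span thus misses the eigenvectors for
  \<open>\<theta> 0\<close> and cannot be everything.\<close>

lemma split_space_Suc: "split_space i (i + 1) = {0}"
proof -
  interpret BA: onsager_pair scale B A d by (rule swap)
  let ?S = "\<Union>i. split_space i (i + 1)"
  have "split_space i (i + 1) \<subseteq> eigenspan A {1..}" for i
  proof (cases "i \<ge> 0")
    case True
    then show ?thesis
      using eigenspan_mono[of "{i + 1..}" "{1..}" A] by (auto simp: split_space_def)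
  next
    case False
    then have "eigenspan B {..i} = {0}"
      by (intro BA.eigenspan_A_empty) auto
    then show ?thesis
      using subspace_0[OF subspace_eigenspan] by (auto simp: split_space_def)
  qed
  then have S: "span ?S \<subseteq> eigenspan A {1..}"
    by (intro span_minimal subspace_eigenspan) blast
  obtain v where "v \<noteq> 0" "A v = scale (\<theta> 0) v"
    by (rule eigenvector_exists[of 0]) simp_all
  then have "v \<notin> eigenspan A {1..}"
    using eigenvector_eigenspan_zero[of v "{1..}" 0] by auto
  then have "span ?S = {0}"
    using S split_space_sum[of 1] by blast
  then show ?thesis
    using span_base[of _ ?S] subspace_0[OF subspace_split_space] by blast
qed

text \<open>An eigenvector of \<open>A\<close> for the top eigenvalue lies in
  \<open>split_space (int d) (int d)\<close>, so the span is not zero.\<close>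

lemma split_space_span: "span (\<Union>i. split_space i i) = UNIV"
proof -
  interpret BA: onsager_pair scale B A d by (rule swap)
  obtain v where v: "v \<noteq> 0" "A v = scale (\<theta> (int d)) v"
    by (rule eigenvector_exists[of "int d"]) simp_all
  have "eigenspan B {..int d} = UNIV"
    by (rule BA.eigenspan_A_UNIV) auto
  moreover have "v \<in> eigenspan A {int d..}"
    unfolding eigenspan_def using v by (intro span_base) auto
  ultimately have "v \<in> (\<Union>i. split_space i i)"
    by (auto simp: split_space_def)
  then show ?thesis
    using v(1) split_space_sum[of 0] span_base[of v "\<Union>i. split_space i i"] by auto
qed

lemma split_space_outside:
  assumes "i \<notin> {0..int d}"
  shows "split_space i i = {0}"
proof -
  interpret BA: onsager_pair scale B A d by (rule swap)
  have "eigenspan B {..i} = {0} \<or> eigenspan A {i..} = {0}"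
    using assms eigenspan_A_empty[of "{i..}"] BA.eigenspan_A_empty[of "{..i}"] by auto
  then show ?thesis
    using subspace_0[OF subspace_eigenspan] by (auto simp: split_space_def)
qed

section \<open>Existence and uniqueness of the decomposition\<close>

lemma split_decomposition_exists:
  "\<exists>u. (\<forall>i. u i \<in> split_space i i) \<and> v = (\<Sum>i\<in>{0..int d}. u i)"
proof -
  have "v \<in> span (\<Union>i. split_space i i)" by (simp add: split_space_span)
  then show ?thesis
  proof (induction rule: span_induct)
    case base
    show ?case
    proof (rule subspaceI)
      show "0 \<in> {v. \<exists>u. (\<forall>i. u i \<in> split_space i i) \<and> v = (\<Sum>i\<in>{0..int d}. u i)}"
        using subspace_0[OF subspace_split_space] by (auto intro!: exI[of _ "\<lambda>i. 0"])
    next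
      fix x y assume "x \<in> {v. \<exists>u. (\<forall>i. u i \<in> split_space i i) \<and> v = (\<Sum>i\<in>{0..int d}. u i)}"
        "y \<in> {v. \<exists>u. (\<forall>i. u i \<in> split_space i i) \<and> v = (\<Sum>i\<in>{0..int d}. u i)}"
      then obtain u w where "\<forall>i. u i \<in> split_space i i" "x = (\<Sum>i\<in>{0..int d}. u i)"
        "\<forall>i. w i \<in> split_space i i" "y = (\<Sum>i\<in>{0..int d}. w i)" by blast
      then show "x + y \<in> {v. \<exists>u. (\<forall>i. u i \<in> split_space i i) \<and> v = (\<Sum>i\<in>{0..int d}. u i)}"
        using subspace_add[OF subspace_split_space]
        by (auto simp: sum.distrib intro!: exI[of _ "\<lambda>i. u i + w i"])
    next
      fix c x assume "x \<in> {v. \<exists>u. (\<forall>i. u i \<in> split_space i i) \<and> v = (\<Sum>i\<in>{0..int d}. u i)}"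
      then obtain u where "\<forall>i. u i \<in> split_space i i" "x = (\<Sum>i\<in>{0..int d}. u i)" by blast
      then show "scale c x \<in> {v. \<exists>u. (\<forall>i. u i \<in> split_space i i) \<and> v = (\<Sum>i\<in>{0..int d}. u i)}"
        using subspace_scale[OF subspace_split_space]
        by (auto simp: scale_sum_right intro!: exI[of _ "\<lambda>i. scale c (u i)"])
    qed
  next
    case (step v)
    then obtain k where k: "v \<in> split_space k k" by blast
    have "v = (\<Sum>i\<in>{0..int d}. if i = k then v else 0)"
      using k split_space_outside[of k] by (cases "k \<in> {0..int d}") auto
    then show ?case
      using k subspace_0[OF subspace_split_space]
      by (intro exI[of _ "\<lambda>i. if i = k then v else 0"]) auto
  qed
qed

text \<open>At the largest index \<open>m\<close> with a nonzero component, \<open>u m\<close> is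
  minus a sum of lower ones, so it lies in \<open>split_space (m - 1) m\<close>, which is
  zero.\<close>

lemma split_decomposition_zero:
  assumes u: "\<And>i. u i \<in> split_space i i" and sum: "(\<Sum>i\<in>{0..int d}. u i) = 0"
  shows "u i = 0"
proof (rule ccontr)
  assume "u i \<noteq> 0"
  define K where "K = {k. u k \<noteq> 0}"
  have "K \<subseteq> {0..int d}"
    using u split_space_outside unfolding K_def by blast
  then have finK: "finite K" using finite_subset by blast
  define m where "m = Max K"
  have "K \<noteq> {}" using \<open>u i \<noteq> 0\<close> by (auto simp: K_def)
  then have m: "m \<in> K" and max: "\<And>k. k \<in> K \<Longrightarrow> k \<le> m"
    using finK by (simp_all add: m_def)
  have "(\<Sum>k\<in>K. u k) = (\<Sum>i\<in>{0..int d}. u i)"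
    using \<open>K \<subseteq> {0..int d}\<close> by (intro sum.mono_neutral_left) (simp_all add: K_def)
  then have "(\<Sum>k\<in>K. u k) = 0"
    using sum by simp
  then have "u m = - (\<Sum>k\<in>K - {m}. u k)"
    using sum.remove[OF finK m, of u] by (simp add: eq_neg_iff_add_eq_0)
  moreover have "(\<Sum>k\<in>K - {m}. u k) \<in> eigenspan B {..m - 1}"
  proof (rule subspace_sum[OF subspace_eigenspan])
    fix k assume "k \<in> K - {m}"
    then have "k \<le> m - 1" using max[of k] by auto
    then show "u k \<in> eigenspan B {..m - 1}"
      using u[of k] eigenspan_mono[of "{..k}" "{..m - 1}" B] by (auto simp: split_space_def)
  qed
  ultimately have "u m \<in> eigenspan B {..m - 1}"
    using subspace_neg[OF subspace_eigenspan] by simp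
  then have "u m \<in> split_space (m - 1) (m - 1 + 1)"
    using u[of m] by (simp add: split_space_def)
  then show False
    using m by (simp add: split_space_Suc[of "m - 1", simplified] K_def)
qed

text \<open>The projections of the decomposition; uniqueness makes the choice immaterial.\<close>

definition split_component :: "'v \<Rightarrow> int \<Rightarrow> 'v" where
  "split_component v = (SOME u. (\<forall>i. u i \<in> split_space i i) \<and> v = (\<Sum>i\<in>{0..int d}. u i))"

lemma split_component: "split_component v i \<in> split_space i i"
  and split_component_sum: "(\<Sum>i\<in>{0..int d}. split_component v i) = v"
  using someI_ex[OF split_decomposition_exists[of v]] by (simp_all add: split_component_def)

lemma split_component_eqI:
  assumes "\<And>i. u i \<in> split_space i i" "v = (\<Sum>i\<in>{0..int d}. u i)"
  shows "split_component v i = u i"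
proof -
  have "split_component v i - u i = 0"
    by (rule split_decomposition_zero[of "\<lambda>i. split_component v i - u i"])
      (use assms subspace_diff[OF subspace_split_space] split_component split_component_sum
        in \<open>auto simp: sum_subtractf\<close>)
  then show ?thesis by simp
qed

text \<open>Let \<open>P\<close> act on the i-th component as \<open>- \<theta> i\<close>. There
  \<open>A\<close> is \<open>\<theta> i\<close> plus a map one component up, and \<open>B\<close> is
  \<open>\<theta> i\<close> plus a map one down. With \<open>n\<close> the image under that map,
  both sides of either relation equal 2n.\<close>

lemma adjacent_exists: "\<exists>P. endo P \<and> adjacent A P \<and> adjacent P B"
proof (intro exI conjI)
  define P where "P v = (\<Sum>i\<in>{0..int d}. scale (- \<theta> i) (split_component v i))" for v
  have add: "split_component (v + w) i = split_component v i + split_component w i" for v w i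
    by (rule split_component_eqI)
      (auto simp: sum.distrib split_component_sum
        intro: subspace_add[OF subspace_split_space] split_component)
  have scl: "split_component (scale c v) i = scale c (split_component v i)" for c v i
    by (rule split_component_eqI)
      (auto simp: scale_sum_right[symmetric] split_component_sum
        intro: subspace_scale[OF subspace_split_space] split_component)
  show P: "endo P"
    unfolding endo_iff P_def
    by (simp add: add scl scale_right_distrib sum_subtractf sum_negf scale_sum_right mult.commute)
  have P_split: "P v = scale (- \<theta> k) v" if v: "v \<in> split_space k k" for k v
  proof -
    have "split_component v i = (if i = k then v else 0)" for i
      by (rule split_component_eqI)
        (use v subspace_0[OF subspace_split_space] split_space_outside[of k] in auto)
    then have "P v = (\<Sum>i\<in>{0..int d}. if i = k then scale (- \<theta> k) v else 0)"
      unfolding P_def by (intro sum.cong) auto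
    then show ?thesis
      using v split_space_outside[of k] by (cases "k \<in> {0..int d}") auto
  qed
  have "A (P v) = P (A v) + (A v + A v) + (P v + P v)" for v
  proof -
    have "v \<in> span (\<Union>i. split_space i i)" by (simp add: split_space_span)
    then show ?thesis
    proof (induction rule: span_induct)
      case base
      show ?case
        by (rule subspace_endo_eq) (use A P in \<open>auto simp: endo_iff algebra_simps\<close>)
    next
      case (step v)
      then obtain i where i: "v \<in> split_space i i" by blast
      define n where "n = A v - scale (\<theta> i) v"
      have Av: "A v = n + scale (\<theta> i) v" by (simp add: n_def)
      have Pv: "P v = scale (- \<theta> i) v" using P_split[OF i] .
      have "P n = scale (- (\<theta> i + 2)) n"
        using P_split[OF split_space_A[OF i]] by (simp only: n_def \<theta>_Suc)
      then have Pn: "P n = - scale (\<theta> i) n - (n + n)"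
        by (simp add: scale_left_distrib scale_left_diff_distrib scale_2)
      show ?case
        using A P by (simp add: Av Pv Pn endo_simps algebra_simps)
    qed
  qed
  then show "adjacent A P" by (simp add: adjacent_iff)
  have "P (B v) = B (P v) + (P v + P v) + (B v + B v)" for v
  proof -
    have "v \<in> span (\<Union>i. split_space i i)" by (simp add: split_space_span)
    then show ?thesis
    proof (induction rule: span_induct)
      case base
      show ?case
        by (rule subspace_endo_eq) (use B P in \<open>auto simp: endo_iff algebra_simps\<close>)
    next
      case (step v)
      then obtain i where i: "v \<in> split_space i i" by blast
      define n where "n = B v - scale (\<theta> i) v"
      have Bv: "B v = n + scale (\<theta> i) v" by (simp add: n_def)
      have Pv: "P v = scale (- \<theta> i) v" using P_split[OF i] .
      have "P n = scale (- (\<theta> i - 2)) n"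
        using P_split[OF split_space_B[OF i]] by (simp only: n_def \<theta>_pred)
      then have Pn: "P n = - scale (\<theta> i) n + (n + n)"
        by (simp add: scale_left_distrib scale_left_diff_distrib scale_2)
      show ?case
        using B P by (simp add: Bv Pv Pn endo_simps algebra_simps)
    qed
  qed
  then show "adjacent P B" by (simp add: adjacent_iff)
qed

end

section \<open>The action of the tetrahedron algebra\<close>

text \<open>A missing generator is the middle edge of a path from \<open>A\<close> or
  \<open>-A\<close> to \<open>B\<close> or \<open>-B\<close>: \<open>P\<close> is X_12 on 0123,
  \<open>Q\<close> is X_02 on 1023, \<open>R\<close> is X_13 on 0132, \<open>S\<close> is X_03 on
  1032.\<close>

lemma (in onsager_pair) tetrahedron_generators_exist:
  obtains Z :: "nat \<Rightarrow> nat \<Rightarrow> 'v \<Rightarrow> 'v"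
  where "Z 0 1 = A" "Z 2 3 = B"
    and "\<And>r s. {r, s} \<subseteq> tetra_index \<Longrightarrow> distinct [r, s] \<Longrightarrow> endo (Z r s)"
    and "\<And>r s v. {r, s} \<subseteq> tetra_index \<Longrightarrow> distinct [r, s] \<Longrightarrow> Z r s v + Z s r v = 0"
    and "\<And>r s t. {r, s, t} \<subseteq> tetra_index \<Longrightarrow> distinct [r, s, t] \<Longrightarrow> adjacent (Z r s) (Z s t)"
    and "\<And>r s t u. {r, s, t, u} \<subseteq> tetra_index \<Longrightarrow> distinct [r, s, t, u] \<Longrightarrow>
      dolan_grady (Z r s) (Z t u)"
proof -
  obtain P where P: "endo P" and AP: "adjacent A P" and PB: "adjacent P B"
    using adjacent_exists by blast
  obtain Q where Q: "endo Q" and AQ: "adjacent (\<lambda>v. - A v) Q" and QB: "adjacent Q B"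
    using onsager_pair.adjacent_exists[OF uminus_left] by blast
  obtain R where R: "endo R" and AR: "adjacent A R" and RB: "adjacent R (\<lambda>v. - B v)"
    using onsager_pair.adjacent_exists[OF uminus_right] by blast
  obtain S where S: "endo S" and AS: "adjacent (\<lambda>v. - A v) S" and SB: "adjacent S (\<lambda>v. - B v)"
    using onsager_pair.adjacent_exists[OF uminus_both] by blast
  note neg = A[THEN endo_uminus_fun] B[THEN endo_uminus_fun] P[THEN endo_uminus_fun]
    Q[THEN endo_uminus_fun] R[THEN endo_uminus_fun] S[THEN endo_uminus_fun]
  note rev = AP[THEN adjacent_reverse[OF A P]] PB[THEN adjacent_reverse[OF P B]]
    AQ[THEN adjacent_reverse[OF neg(1) Q], simplified] QB[THEN adjacent_reverse[OF Q B]]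
    AR[THEN adjacent_reverse[OF A R]] RB[THEN adjacent_reverse[OF R neg(2)], simplified]
    AS[THEN adjacent_reverse[OF neg(1) S], simplified]
    SB[THEN adjacent_reverse[OF S neg(2)], simplified]
  have PQ: "adjacent P (\<lambda>v. - Q v)"
    by (rule adjacent_third[OF P Q AP PB AQ QB])
  \<comment> \<open>The previous relation with indices 2 and 3 exchanged.\<close>
  have RS: "adjacent R (\<lambda>v. - S v)"
    by (rule onsager_pair.adjacent_third[OF uminus_right R S AR RB AS SB])
  \<comment> \<open>The symmetry \<open>0123 \<mapsto> 3210\<close> of the indices; for \<open>Q\<close> and \<open>S\<close> below, \<open>0123 \<mapsto> 3201\<close>.\<close>
  have "adjacent (\<lambda>v. - P v) (\<lambda>v. - (- R v))"
    by (rule onsager_pair.adjacent_third[OF onsager_pair.swap[OF uminus_both] neg(3,5)])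
      (simp_all add: rev)
  then have PR: "adjacent (\<lambda>v. - P v) R" by simp
  have "adjacent (\<lambda>v. - Q v) (\<lambda>v. - (- S v))"
    by (rule onsager_pair.adjacent_third[OF onsager_pair.swap[OF uminus_right] neg(4,6)])
      (simp_all add: rev)
  then have QS: "adjacent (\<lambda>v. - Q v) S" by simp
  note rev' = PQ[THEN adjacent_reverse[OF P neg(4)], simplified]
    RS[THEN adjacent_reverse[OF R neg(6)], simplified]
    PR[THEN adjacent_reverse[OF neg(3) R], simplified]
    QS[THEN adjacent_reverse[OF neg(4) S], simplified]
  note adj = AP PB AQ QB AR RB AS SB PQ RS PR QS rev rev'
  \<comment> \<open>Relation (iii) for the two remaining pairs of opposite edges. The three facts
    after the first come from it by exchanging 0 with 1, or 2 with 3, or both.\<close>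
  have QR: "dolan_grady Q R"
    by (rule adjacent_dolan_grady[OF Q R AQ QB AR RB])
  have RQ: "dolan_grady R Q"
    by (rule onsager_pair.adjacent_dolan_grady[OF uminus_both R Q]) (simp_all add: adj)
  have SP: "dolan_grady S P"
    by (rule onsager_pair.adjacent_dolan_grady[OF uminus_right S P]) (simp_all add: adj)
  have PS: "dolan_grady P S"
    by (rule onsager_pair.adjacent_dolan_grady[OF uminus_left P S]) (simp_all add: adj)
  have dg: "dolan_grady f g \<and> dolan_grady (\<lambda>v. - f v) g \<and> dolan_grady f (\<lambda>v. - g v) \<and>
      dolan_grady (\<lambda>v. - f v) (\<lambda>v. - g v)" if "endo f" "endo g" "dolan_grady f g" for f g
    using that by (simp add: dolan_grady_uminus endo_uminus_fun)
  note dg_all = dg[OF A B dolan_grady_AB] dg[OF B A dolan_grady_BA] dg[OF Q R QR] dg[OF R Q RQ]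
    dg[OF S P SP] dg[OF P S PS]
  \<comment> \<open>Only \<open>r < s\<close> matters here, so the default branches stand for X_03,
    X_13 and X_23.\<close>
  define Y where "Y r s = (if r = 0 then if s = 1 then A else if s = 2 then Q else S
      else if r = 1 then if s = 2 then P else R else B)" for r s :: nat
  define Z where "Z r s = (if r < s then Y r s else (\<lambda>v. - Y s r v))" for r s
  show thesis
  proof
    show "Z 0 1 = A" "Z 2 3 = B"
      by (simp_all add: Z_def Y_def)
    show "endo (Z r s)" for r s
      using A B P Q R S neg by (simp add: Z_def Y_def)
    show "Z r s v + Z s r v = 0" if "{r, s} \<subseteq> tetra_index" "distinct [r, s]" for r s v
      using that by (auto simp: Z_def)
    have "\<forall>r\<in>tetra_index. \<forall>s\<in>tetra_index. \<forall>t\<in>tetra_index. distinct [r, s, t] \<longrightarrow>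
        adjacent (Z r s) (Z s t)"
      by (simp add: tetra_index_def Z_def Y_def adj)
    then show "adjacent (Z r s) (Z s t)" if "{r, s, t} \<subseteq> tetra_index" "distinct [r, s, t]" for r s t
      using that by blast
    have "\<forall>r\<in>tetra_index. \<forall>s\<in>tetra_index. \<forall>t\<in>tetra_index. \<forall>u\<in>tetra_index.
        distinct [r, s, t, u] \<longrightarrow> dolan_grady (Z r s) (Z t u)"
      by (simp add: tetra_index_def Z_def Y_def dg_all)
    then show "dolan_grady (Z r s) (Z t u)"
      if "{r, s, t, u} \<subseteq> tetra_index" "distinct [r, s, t, u]" for r s t u
      using that by blast
  qed
qed

section \<open>Evaluation of Lie terms as operators\<close>

primrec lie_term_action ::
  "('k \<Rightarrow> 'v \<Rightarrow> 'v) \<Rightarrow> ('g \<Rightarrow> 'v \<Rightarrow> 'v) \<Rightarrow> ('k, 'g) lie_term \<Rightarrow> 'v \<Rightarrow> 'v::ab_group_add" where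
  "lie_term_action scale \<phi> (Gen g) = \<phi> g"
| "lie_term_action scale \<phi> Zero = (\<lambda>v. 0)"
| "lie_term_action scale \<phi> (Add s t) =
    (\<lambda>v. lie_term_action scale \<phi> s v + lie_term_action scale \<phi> t v)"
| "lie_term_action scale \<phi> (Neg s) = (\<lambda>v. - lie_term_action scale \<phi> s v)"
| "lie_term_action scale \<phi> (Scale c s) = (\<lambda>v. scale c (lie_term_action scale \<phi> s v))"
| "lie_term_action scale \<phi> (Bracket s t) =
    commutator (lie_term_action scale \<phi> s) (lie_term_action scale \<phi> t)"

lemma (in char_0_space) endo_lie_term_action:
  assumes "\<And>g. endo (\<phi> g)"
  shows "endo (lie_term_action scale \<phi> t)"
  by (induction t) (simp_all add: assms endo_intros)

text \<open>The universal property of the presentation: commutators of linear operators satisfy the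
  Lie axioms by themselves, so only the relations in \<open>R\<close> remain to be checked.\<close>

lemma (in char_0_space) lie_term_action_cong:
  assumes \<phi>: "\<And>g. endo (\<phi> g)"
    and R: "\<And>s t. (s, t) \<in> R \<Longrightarrow> lie_term_action scale \<phi> s = lie_term_action scale \<phi> t"
    and "lie_eq R s t"
  shows "lie_term_action scale \<phi> s = lie_term_action scale \<phi> t"
  using assms(3)
proof induction
  case (relation s t)
  then show ?case by (rule R)
qed (auto simp: commutator_def endo_simps[OF endo_lie_term_action[OF \<phi>]] algebra_simps)

section \<open>Relations and induction principles of the presented algebras\<close>

lemma tetra_X_relations:
  assumes "{r, s} \<subseteq> tetra_index" "distinct [r, s]"
  shows "tetra_X r s + tetra_X s r = (0 :: 'k::field tetrahedron)"
  using assms by transfer (intro lie_eq.relation, auto simp: tetra_relations_def)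

lemma tetra_X_bracket:
  assumes "{r, s, t} \<subseteq> tetra_index" "distinct [r, s, t]"
  shows "tetra_bracket (tetra_X r s) (tetra_X s t) =
    tetra_scale (2 :: 'k::field) (tetra_X r s) + tetra_scale 2 (tetra_X s t)"
  using assms by transfer (intro lie_eq.relation, auto simp: tetra_relations_def)

lemma onsager_dolan_grady:
  "onsager_bracket onsager_X (onsager_bracket onsager_X (onsager_bracket onsager_X onsager_Y)) =
    onsager_scale (4 :: 'k::field) (onsager_bracket onsager_X onsager_Y)"
  "onsager_bracket onsager_Y (onsager_bracket onsager_Y (onsager_bracket onsager_Y onsager_X)) =
    onsager_scale (4 :: 'k::field) (onsager_bracket onsager_Y onsager_X)"
  by (transfer, intro lie_eq.relation, simp add: onsager_relations_def Let_def)+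

lemma onsager_induct [case_names X Y zero add uminus scale bracket]:
  fixes x :: "'k::field onsager"
  assumes "p onsager_X" "p onsager_Y" "p 0" "\<And>x y. p x \<Longrightarrow> p y \<Longrightarrow> p (x + y)"
    "\<And>x. p x \<Longrightarrow> p (- x)" "\<And>c x. p x \<Longrightarrow> p (onsager_scale c x)"
    "\<And>x y. p x \<Longrightarrow> p y \<Longrightarrow> p (onsager_bracket x y)"
  shows "p x"
proof -
  have "p (abs_onsager t)" for t :: "('k, onsager_gen) lie_term"
  proof (induction t)
    case (Gen g)
    then show ?case
      using assms(1,2) by (cases g) (simp_all add: onsager_X_def onsager_Y_def)
  qed (use assms in \<open>simp_all add: zero_onsager_def plus_onsager.abs_eq[symmetric]
      uminus_onsager.abs_eq[symmetric] onsager_scale.abs_eq[symmetric]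
      onsager_bracket.abs_eq[symmetric]\<close>)
  then show ?thesis by (rule onsager.abs_induct)
qed

text \<open>Every element is the class of a term, and every generator has an admissible index pair,
  so the unspecified values of \<open>tetra_X\<close> never arise.\<close>

lemma tetrahedron_induct [case_names X zero add uminus scale bracket]:
  fixes x :: "'k::field tetrahedron"
  assumes "\<And>r s. {r, s} \<subseteq> tetra_index \<Longrightarrow> distinct [r, s] \<Longrightarrow> p (tetra_X r s)"
    "p 0" "\<And>x y. p x \<Longrightarrow> p y \<Longrightarrow> p (x + y)"
    "\<And>x. p x \<Longrightarrow> p (- x)" "\<And>c x. p x \<Longrightarrow> p (tetra_scale c x)"
    "\<And>x y. p x \<Longrightarrow> p y \<Longrightarrow> p (tetra_bracket x y)"
  shows "p x"
proof -
  have "p (abs_tetrahedron t)" for t :: "('k, tetra_gen) lie_term"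
  proof (induction t)
    case (Gen g)
    obtain r s where "g = Abs_tetra_gen (r, s)" "{r, s} \<subseteq> tetra_index" "distinct [r, s]"
      by (cases g) auto
    then show ?case
      using assms(1) by (simp add: tetra_X_def)
  qed (use assms in \<open>simp_all add: zero_tetrahedron_def plus_tetrahedron.abs_eq[symmetric]
      uminus_tetrahedron.abs_eq[symmetric] tetra_scale.abs_eq[symmetric]
      tetra_bracket.abs_eq[symmetric]\<close>)
  then show ?thesis by (rule tetrahedron.abs_induct)
qed

section \<open>Passage between modules and operators\<close>

context lie_module
begin

lemma act_simps:
  "act (x + y) v = act x v + act y v" "act (scaleL c x) v = scaleV c (act x v)"
  "act x (v + w) = act x v + act x w" "act x (scaleV c v) = scaleV c (act x v)"
  using act_linear_left[of v] act_linear_right[of x] by (simp_all add: Vector_Spaces.linear_iff)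

lemma act_0: "act 0 v = 0"
  using act_simps(1)[of 0 0 v] by simp

lemma act_uminus: "act (- x) v = - act x v"
  using act_simps(1)[of x "- x" v] by (simp add: act_0 add_eq_0_iff)

lemma act_bracket_commutator: "act (bracket x y) = commutator (act x) (act y)"
  by (simp add: commutator_def act_bracket fun_eq_iff)

end

text \<open>As X and Y generate the algebra, this turns irreducibility of the module into
  irreducibility of the pair of operators.\<close>

lemma onsager_module_invariant:
  fixes scaleV :: "'k::field \<Rightarrow> 'v::ab_group_add \<Rightarrow> 'v"
  assumes "lie_module onsager_scale onsager_bracket scaleV act"
    and W: "module.subspace scaleV W"
    and "\<And>w. w \<in> W \<Longrightarrow> act onsager_X w \<in> W" "\<And>w. w \<in> W \<Longrightarrow> act onsager_Y w \<in> W"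
    and "w \<in> W"
  shows "act x w \<in> W"
proof -
  interpret lie_module onsager_scale onsager_bracket scaleV act by fact
  \<comment> \<open>The vector is quantified because a bracket applies one factor to the image of
    the other.\<close>
  have "\<forall>w\<in>W. act x w \<in> W"
    by (induction x rule: onsager_induct)
      (use assms in \<open>auto simp: act_simps act_0 act_uminus act_bracket V.subspace_0 V.subspace_add
        V.subspace_neg V.subspace_scale V.subspace_diff\<close>)
  then show ?thesis using \<open>w \<in> W\<close> by blast
qed

lemma onsager_pair_of_module:
  fixes scaleV :: "'k::field_char_0 \<Rightarrow> 'v::ab_group_add \<Rightarrow> 'v"
  assumes "irreducible_lie_module onsager_scale onsager_bracket scaleV act"
    and "has_onsager_type scaleV act (0, 0)"
  obtains d where "onsager_pair scaleV (act onsager_X) (act onsager_Y) d"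
proof -
  interpret irreducible_lie_module onsager_scale onsager_bracket scaleV act by fact
  interpret char_0_space scaleV by unfold_locales
  obtain d where d: "eigenvalues scaleV (act onsager_X) = {of_nat d - 2 * of_nat i | i. i \<le> d}"
    "eigenvalues scaleV (act onsager_Y) = {of_nat d - 2 * of_nat i | i. i \<le> d}"
    using assms(2) by (auto simp: has_onsager_type_def)
  have "onsager_pair scaleV (act onsager_X) (act onsager_Y) d"
  proof (intro onsager_pair.intro onsager_pair_axioms.intro)
    show "dolan_grady (act onsager_X) (act onsager_Y)" "dolan_grady (act onsager_Y) (act onsager_X)"
      unfolding dolan_grady_def act_bracket_commutator[symmetric] onsager_dolan_grady
      by (simp_all add: act_simps)
    show "W = {0} \<or> W = UNIV" if "V.subspace W" "\<And>w. w \<in> W \<Longrightarrow> act onsager_X w \<in> W"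
        "\<And>w. w \<in> W \<Longrightarrow> act onsager_Y w \<in> W" for W
      using irreducible[OF that(1)] onsager_module_invariant[OF lie_module_axioms that] by blast
  qed (fact char_0_space_axioms act_linear_right d)+
  then show thesis by (rule that)
qed

lemma (in onsager_pair) tetrahedron_module_exists:
  "\<exists>\<rho>. lie_module tetra_scale tetra_bracket scale \<rho> \<and> \<rho> (tetra_X 0 1) = A \<and> \<rho> (tetra_X 2 3) = B"
proof -
  obtain Z :: "nat \<Rightarrow> nat \<Rightarrow> 'v \<Rightarrow> 'v" where Z01: "Z 0 1 = A" and Z23: "Z 2 3 = B"
    and endoZ: "\<And>r s. {r, s} \<subseteq> tetra_index \<Longrightarrow> distinct [r, s] \<Longrightarrow> endo (Z r s)"
    and anti: "\<And>r s v. {r, s} \<subseteq> tetra_index \<Longrightarrow> distinct [r, s] \<Longrightarrow> Z r s v + Z s r v = 0"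
    and adj: "\<And>r s t. {r, s, t} \<subseteq> tetra_index \<Longrightarrow> distinct [r, s, t] \<Longrightarrow> adjacent (Z r s) (Z s t)"
    and dg: "\<And>r s t u. {r, s, t, u} \<subseteq> tetra_index \<Longrightarrow> distinct [r, s, t, u] \<Longrightarrow>
      dolan_grady (Z r s) (Z t u)"
    using tetrahedron_generators_exist by blast
  define \<phi> where "\<phi> g = (case Rep_tetra_gen g of (r, s) \<Rightarrow> Z r s)" for g
  have \<phi>: "\<phi> (Abs_tetra_gen (r, s)) = Z r s" if "{r, s} \<subseteq> tetra_index" "distinct [r, s]" for r s
    using that by (simp add: \<phi>_def Abs_tetra_gen_inverse)
  have endo\<phi>: "endo (\<phi> g)" for g
  proof -
    obtain r s where "g = Abs_tetra_gen (r, s)" "{r, s} \<subseteq> tetra_index" "distinct [r, s]"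
      by (cases g) auto
    then show ?thesis using endoZ \<phi> by simp
  qed
  define ev where "ev = lie_term_action scale \<phi>"
  have "ev s = ev t" if "(s, t) \<in> tetra_relations" for s t
    using that unfolding tetra_relations_def
  proof (elim UnE CollectE exE conjE)
    fix r s' assume "(s, t) = (Add (tetra_Gen r s') (tetra_Gen s' r), Zero)"
      "{r, s'} \<subseteq> tetra_index" "distinct [r, s']"
    then show "ev s = ev t"
      using anti[of r s'] by (simp add: ev_def \<phi>)
  next
    fix r s' t' assume "(s, t) = (Bracket (tetra_Gen r s') (tetra_Gen s' t'),
        Add (Scale 2 (tetra_Gen r s')) (Scale 2 (tetra_Gen s' t')))"
      "{r, s', t'} \<subseteq> tetra_index" "distinct [r, s', t']"
    then show "ev s = ev t"
      using adj[of r s' t'] by (simp add: ev_def \<phi> adjacent_def fun_eq_iff)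
  next
    fix r s' t' u assume "(s, t) = (Bracket (tetra_Gen r s') (Bracket (tetra_Gen r s')
        (Bracket (tetra_Gen r s') (tetra_Gen t' u))),
        Scale 4 (Bracket (tetra_Gen r s') (tetra_Gen t' u)))"
      "{r, s', t', u} \<subseteq> tetra_index" "distinct [r, s', t', u]"
    then show "ev s = ev t"
      using dg[of r s' t' u] by (simp add: ev_def \<phi> dolan_grady_def fun_eq_iff)
  qed
  then have ev_cong: "ev s = ev t" if "lie_eq tetra_relations s t" for s t
    using lie_term_action_cong[OF endo\<phi> _ that] by (simp add: ev_def)
  \<comment> \<open>Evaluation at a chosen representative; \<open>ev_cong\<close> makes it
    independent of the choice.\<close>
  define \<rho> where "\<rho> x = ev (rep_tetrahedron x)" for x
  have \<rho>: "\<rho> (abs_tetrahedron t) = ev t" for t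
    unfolding \<rho>_def
    by (intro ev_cong Quotient3_rep_abs[OF Quotient3_tetrahedron] lie_eq.refl)
  have endo\<rho>: "endo (\<rho> x)" for x
    unfolding \<rho>_def ev_def by (rule endo_lie_term_action[OF endo\<phi>])
  have \<rho>_add: "\<rho> (x + y) v = \<rho> x v + \<rho> y v"
    and \<rho>_scale: "\<rho> (tetra_scale c x) v = scale c (\<rho> x v)"
    and \<rho>_bracket: "\<rho> (tetra_bracket x y) = commutator (\<rho> x) (\<rho> y)" for x y c v
    by (induction x rule: tetrahedron.abs_induct, induction y rule: tetrahedron.abs_induct,
        simp add: \<rho> plus_tetrahedron.abs_eq tetra_scale.abs_eq tetra_bracket.abs_eq ev_def)+
  interpret T: lie_algebra "tetra_scale :: 'k \<Rightarrow> _" tetra_bracket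
    by (rule lie_algebra_tetrahedron)
  have "lie_module tetra_scale tetra_bracket scale \<rho>"
  proof (intro lie_module.intro lie_module_axioms.intro)
    show "Vector_Spaces.linear tetra_scale scale (\<lambda>x. \<rho> x v)" for v
      by (simp add: Vector_Spaces.linear_iff \<rho>_add \<rho>_scale T.vector_space_axioms vector_space_axioms)
    show "\<rho> (tetra_bracket x y) v = \<rho> x (\<rho> y v) - \<rho> y (\<rho> x v)" for x y v
      by (simp add: \<rho>_bracket commutator_def)
  qed (fact T.lie_algebra_axioms vector_space_axioms endo\<rho>)+
  moreover have "\<rho> (tetra_X 0 1) = A" "\<rho> (tetra_X 2 3) = B"
    using Z01 Z23 by (simp_all add: tetra_X_def \<rho> ev_def \<phi> tetra_index_def)
  ultimately show ?thesis by blast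
qed

text \<open>Each missing generator is joined by relation (ii) to \<open>A\<close> or
  \<open>-A\<close> and to \<open>B\<close> or \<open>-B\<close>, which determines it; induction
  extends the agreement to the whole algebra.\<close>

lemma (in onsager_pair) tetrahedron_module_unique:
  assumes \<rho>: "lie_module tetra_scale tetra_bracket scale \<rho>"
      "\<rho> (tetra_X 0 1) = A" "\<rho> (tetra_X 2 3) = B"
    and \<rho>': "lie_module tetra_scale tetra_bracket scale \<rho>'"
      "\<rho>' (tetra_X 0 1) = A" "\<rho>' (tetra_X 2 3) = B"
  shows "\<rho> = \<rho>'"
proof
  interpret M: lie_module tetra_scale tetra_bracket scale \<rho> by fact
  interpret M': lie_module tetra_scale tetra_bracket scale \<rho>' by fact
  note ind = tetra_index_def
  have neg: "\<sigma> (tetra_X s r) = (\<lambda>v. - \<sigma> (tetra_X r s) v)"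
    if "lie_module tetra_scale tetra_bracket scale \<sigma>"
      and "{r, s} \<subseteq> tetra_index" "distinct [r, s]" for \<sigma> r s
  proof
    fix v
    interpret N: lie_module tetra_scale tetra_bracket scale \<sigma> by fact
    have "\<sigma> (tetra_X r s) v + \<sigma> (tetra_X s r) v = 0"
      using tetra_X_relations[OF that(2,3)] N.act_simps(1) N.act_0 by metis
    then show "\<sigma> (tetra_X s r) v = - \<sigma> (tetra_X r s) v"
      by (simp add: add_eq_0_iff)
  qed
  have adj: "adjacent (\<sigma> (tetra_X r s)) (\<sigma> (tetra_X s t))"
    if "lie_module tetra_scale tetra_bracket scale \<sigma>"
      and "{r, s, t} \<subseteq> tetra_index" "distinct [r, s, t]" for \<sigma> r s t
  proof -
    interpret N: lie_module tetra_scale tetra_bracket scale \<sigma> by fact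
    show ?thesis
      unfolding adjacent_def N.act_bracket_commutator[symmetric] tetra_X_bracket[OF that(2,3)]
      by (simp add: N.act_simps)
  qed
  have eq12: "\<rho> (tetra_X 1 2) = \<rho>' (tetra_X 1 2)"
    using adj[OF \<rho>(1), of 0 1 2] adj[OF \<rho>(1), of 1 2 3] adj[OF \<rho>'(1), of 0 1 2] adj[OF \<rho>'(1), of 1 2 3]
    by (intro adjacent_unique M.act_linear_right M'.act_linear_right)
      (simp_all add: \<rho> \<rho>' ind del: One_nat_def)
  \<comment> \<open>The path 1, 0, 2, 3 starts with X_10, which acts as \<open>-A\<close>; hence the
    pair with \<open>A\<close> negated.\<close>
  have eq02: "\<rho> (tetra_X 0 2) = \<rho>' (tetra_X 0 2)"
    using adj[OF \<rho>(1), of 1 0 2] adj[OF \<rho>(1), of 0 2 3] adj[OF \<rho>'(1), of 1 0 2] adj[OF \<rho>'(1), of 0 2 3]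
      neg[OF \<rho>(1), of 0 1] neg[OF \<rho>'(1), of 0 1]
    by (intro onsager_pair.adjacent_unique[OF uminus_left] M.act_linear_right M'.act_linear_right)
      (simp_all add: \<rho> \<rho>' ind del: One_nat_def)
  have eq13: "\<rho> (tetra_X 1 3) = \<rho>' (tetra_X 1 3)"
    using adj[OF \<rho>(1), of 0 1 3] adj[OF \<rho>(1), of 1 3 2] adj[OF \<rho>'(1), of 0 1 3] adj[OF \<rho>'(1), of 1 3 2]
      neg[OF \<rho>(1), of 2 3] neg[OF \<rho>'(1), of 2 3]
    by (intro onsager_pair.adjacent_unique[OF uminus_right] M.act_linear_right M'.act_linear_right)
      (simp_all add: \<rho> \<rho>' ind del: One_nat_def)
  have eq03: "\<rho> (tetra_X 0 3) = \<rho>' (tetra_X 0 3)"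
    using adj[OF \<rho>(1), of 1 0 3] adj[OF \<rho>(1), of 0 3 2] adj[OF \<rho>'(1), of 1 0 3] adj[OF \<rho>'(1), of 0 3 2]
      neg[OF \<rho>(1), of 0 1] neg[OF \<rho>'(1), of 0 1] neg[OF \<rho>(1), of 2 3] neg[OF \<rho>'(1), of 2 3]
    by (intro onsager_pair.adjacent_unique[OF uminus_both] M.act_linear_right M'.act_linear_right)
      (simp_all add: \<rho> \<rho>' ind del: One_nat_def)
  have le: "\<rho> (tetra_X r s) = \<rho>' (tetra_X r s)" if "r < s" "{r, s} \<subseteq> tetra_index" for r s
    using that \<rho> \<rho>' eq12 eq02 eq13 eq03 by (auto simp: ind simp del: One_nat_def)
  fix x
  show "\<rho> x = \<rho>' x"
  proof (induction x rule: tetrahedron_induct)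
    case (X r s)
    show ?case
    proof (cases "r < s")
      case True
      then show ?thesis using X le by blast
    next
      case False
      then have "s < r" using X by simp
      then show ?thesis
        using X le[of s r] neg[OF \<rho>(1), of s r] neg[OF \<rho>'(1), of s r] by auto
    qed
  qed (auto simp: M.act_simps M'.act_simps M.act_0 M'.act_0 M.act_uminus M'.act_uminus
      M.act_bracket M'.act_bracket fun_eq_iff)
qed

theorem theorem1p8:
  fixes scaleV :: "'k::{alg_closed_field, field_char_0} \<Rightarrow> 'v::ab_group_add \<Rightarrow> 'v"
    and Basis :: "'v set"
    and act :: "'k onsager \<Rightarrow> 'v \<Rightarrow> 'v"
  assumes "finite_dimensional_vector_space scaleV Basis"
    and "irreducible_lie_module onsager_scale onsager_bracket scaleV act"
    and "has_onsager_type scaleV act (0, 0)"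
  shows "(\<exists>!\<rho> :: 'k tetrahedron \<Rightarrow> 'v \<Rightarrow> 'v.
            lie_module tetra_scale tetra_bracket scaleV \<rho> \<and>
            \<rho> (tetra_X 0 1) = act onsager_X \<and> \<rho> (tetra_X 2 3) = act onsager_Y) \<and>
         (\<forall>\<rho> :: 'k tetrahedron \<Rightarrow> 'v \<Rightarrow> 'v.
            lie_module tetra_scale tetra_bracket scaleV \<rho> \<and>
            \<rho> (tetra_X 0 1) = act onsager_X \<and> \<rho> (tetra_X 2 3) = act onsager_Y \<longrightarrow>
            irreducible_lie_module tetra_scale tetra_bracket scaleV \<rho>)"
proof (intro conjI allI impI)
  interpret O: irreducible_lie_module onsager_scale onsager_bracket scaleV act by fact
  obtain d where "onsager_pair scaleV (act onsager_X) (act onsager_Y) d"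
    using onsager_pair_of_module[OF assms(2,3)] .
  then interpret onsager_pair scaleV "act onsager_X" "act onsager_Y" d .
  show "\<exists>!\<rho>. lie_module tetra_scale tetra_bracket scaleV \<rho> \<and>
      \<rho> (tetra_X 0 1) = act onsager_X \<and> \<rho> (tetra_X 2 3) = act onsager_Y"
    using tetrahedron_module_exists tetrahedron_module_unique by blast
  fix \<rho> :: "'k tetrahedron \<Rightarrow> 'v \<Rightarrow> 'v"
  assume \<rho>: "lie_module tetra_scale tetra_bracket scaleV \<rho> \<and>
      \<rho> (tetra_X 0 1) = act onsager_X \<and> \<rho> (tetra_X 2 3) = act onsager_Y"
  show "irreducible_lie_module tetra_scale tetra_bracket scaleV \<rho>"
  proof (intro irreducible_lie_module.intro irreducible_lie_module_axioms.intro)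
    show "lie_module tetra_scale tetra_bracket scaleV \<rho>" using \<rho> by blast
    show "\<exists>v::'v. v \<noteq> 0" by (rule O.nonzero)
    \<comment> \<open>Invariance under \<open>\<rho>\<close> includes invariance under the images of
      X_01 and X_23, that is, under X and Y.\<close>
    show "W = {0} \<or> W = UNIV" if "O.V.subspace W" "\<And>x w. w \<in> W \<Longrightarrow> \<rho> x w \<in> W" for W
      using that \<rho> irreducible_AB[of W] by metis
  qed
qed

end
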